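(* Let $\rightsquigarrow$ be a 2-eternal relation, $G$ a finite group, $p$ a prime divisor of $|G|$, and $S$ a Sylow $p$-subgroup of $G$. Suppose that there exists a subgroup $D$ of $S$ with $1<|D|<|S|$ such that every subgroup of $S$ of order $|D|$ or $p|D|$ is abelian, every subgroup $H$ of $S$ of order $|D|$ satisfies $H\rightsquigarrow G$, and, if $S$ is non-abelian, $|S|>4$ and $p=2$, every cyclic subgroup $H$ of $S$ of order $4$ satisfies $H\rightsquigarrow G$. Then $\mathcal{F}_S(G)$ is supersolvable.
   Context: All groups are finite. $Z_{\mathfrak{U}}(G)$ denotes the supersolvable hypercenter of $G$: the largest normal subgroup $N$ of $G$ such that every chief factor of $G$ below $N$ is cyclic (of prime order). Let $\rightsquigarrow$ be a relation, defined for every finite group $G$, between subgroups $H\le G$ and $G$ (written $H\rightsquigarrow G$). It is called 2-eternal if for every finite group $G$ the following hold: (0) for all subgroups $H\le K\le G$, if $H\rightsquigarrow G$ then $H\rightsquigarrow K$; (2) for every prime divisor $p$ of $|G|$: if there exists a subgroup $D$ of $O_p(G)$ with $1<|D|<|O_p(G)|$ such that every subgroup $H$ of $O_p(G)$ of order $|D|$ satisfies $H\rightsquigarrow G$ and, in case $O_p(G)$ is non-abelian, $|O_p(G)|>4$ and $|D|=2$, every cyclic subgroup $H$ of $O_p(G)$ of order $4$ satisfies $H\rightsquigarrow G$, then $O_p(G)\le Z_{\mathfrak{U}}(G)$. $\mathcal{F}_S(G)$ is the (saturated) fusion system on $S\in\mathrm{Syl}_p(G)$ whose objects are the subgroups of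 $S$ and whose morphisms $P\to Q$ are the maps $x\mapsto x^g$ with $g\in G$, $P^g\le Q$. A saturated fusion system $\mathcal{F}$ on a $p$-group $S$ is supersolvable if there is a series $1=S_0\le S_1\le\cdots\le S_n=S$ of strongly $\mathcal{F}$-closed subgroups of $S$ with $S_{i+1}/S_i$ cyclic for $0\le i\le n-1$. (A subgroup $T\le S$ is strongly $\mathcal{F}$-closed if for every $P\le T$ and every $\phi\in\mathrm{Hom}_{\mathcal{F}}(P,S)$ one has $P^{\phi}\le T$.) *)

theory Defs
  imports "HOL-Algebra.Algebra"
begin

abbreviation subgrp :: "'a monoid \<Rightarrow> 'a set \<Rightarrow> 'a monoid"
  where "subgrp G H \<equiv> G\<lparr>carrier := H\<rparr>"

definition sylow_subgroup :: "nat \<Rightarrow> 'a monoid \<Rightarrow> 'a set \<Rightarrow> bool"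
  where "sylow_subgroup p G S \<longleftrightarrow>
    subgroup S G \<and> card S = p ^ multiplicity p (Coset.order G)"

(* O_p(G). In a finite group the product of two normal p-subgroups is again one,
   so for prime p the greatest element exists. *)
definition p_core :: "nat \<Rightarrow> 'a monoid \<Rightarrow> 'a set"
  where "p_core p G = (GREATEST N. N \<lhd> G \<and> (\<exists>n. card N = p ^ n))"

(* H/K is a chief factor of G. *)
definition chief_factor :: "'a monoid \<Rightarrow> 'a set \<Rightarrow> 'a set \<Rightarrow> bool"
  where "chief_factor G H K \<longleftrightarrow>
    H \<lhd> G \<and> K \<lhd> G \<and> K \<subset> H \<and> (\<nexists>L. L \<lhd> G \<and> K \<subset> L \<and> L \<subset> H)"

(* Z_U(G). For finite G, normal subgroups with the property below are closed under
   products, so the greatest one exists. *)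
definition supersolvable_hypercenter :: "'a monoid \<Rightarrow> 'a set"
  where "supersolvable_hypercenter G = (GREATEST N. N \<lhd> G \<and>
    (\<forall>H K. chief_factor G H K \<and> H \<subseteq> N \<longrightarrow> cyclic_group (subgrp G H Mod K)))"

(* R H G stands for "H is related to G"; it is only ever used for subgroups H of a finite
   group G. The relation covers all finite groups with elements in the type 'a, where 'a is
   arbitrary. This loses no generality: both conditions below compare only a group with
   its own subgroups, so a relation that is 2-eternal on this type can be extended
   to all finite groups by letting it fail elsewhere, and conversely any relation on all
   finite groups can be restricted to this type. *)
definition two_eternal :: "('a set \<Rightarrow> 'a monoid \<Rightarrow> bool) \<Rightarrow> bool"
  where "two_eternal R \<longleftrightarrow> (\<forall>G. group G \<and> finite (carrier G) \<longrightarrow>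
    (\<forall>H K. subgroup K G \<and> subgroup H (subgrp G K) \<and> R H G \<longrightarrow> R H (subgrp G K)) \<and>
    (\<forall>p. Factorial_Ring.prime p \<and> p dvd Coset.order G \<longrightarrow>
      (let P = p_core p G in
        (\<exists>D. subgroup D (subgrp G P) \<and> 1 < card D \<and> card D < card P \<and>
          (\<forall>H. subgroup H (subgrp G P) \<and> card H = card D \<longrightarrow> R H G) \<and>
          (\<not> comm_group (subgrp G P) \<and> card P > 4 \<and> card D = 2 \<longrightarrow>
            (\<forall>H. subgroup H (subgrp G P) \<and> cyclic_group (subgrp G H) \<and> card H = 4
               \<longrightarrow> R H G)))
        \<longrightarrow> P \<subseteq> supersolvable_hypercenter G)))"

(* The morphism sets of a fusion system, F P Q = Hom_F(P, Q). *)
type_synonym 'a fusion = "'a set \<Rightarrow> 'a set \<Rightarrow> ('a \<Rightarrow> 'a) set"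

(* Maps are extensional (undefined off P), so that equal maps on P are equal functions. *)
definition fusion_system :: "'a monoid \<Rightarrow> 'a set \<Rightarrow> 'a fusion"
  where "fusion_system G S P Q =
    {\<phi>. subgroup P (subgrp G S) \<and> subgroup Q (subgrp G S) \<and>
       (\<exists>g\<in>carrier G. \<phi> = (\<lambda>x\<in>P. inv\<^bsub>G\<^esub> g \<otimes>\<^bsub>G\<^esub> x \<otimes>\<^bsub>G\<^esub> g) \<and> \<phi> ` P \<subseteq> Q)}"

(* T is strongly F-closed, F a fusion system on the group S. *)
definition strongly_closed :: "'a monoid \<Rightarrow> 'a fusion \<Rightarrow> 'a set \<Rightarrow> bool"
  where "strongly_closed S F T \<longleftrightarrow> subgroup T S \<and>
    (\<forall>P \<phi>. subgroup P S \<and> P \<subseteq> T \<and> \<phi> \<in> F P (carrier S) \<longrightarrow> \<phi> ` P \<subseteq> T)"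

(* The notion is meant for saturated fusion systems F on S. The quotients make sense because
   strongly F-closed subgroups are normal in S (F contains conjugation by elements of S). *)
definition supersolvable_fusion :: "'a monoid \<Rightarrow> 'a fusion \<Rightarrow> bool"
  where "supersolvable_fusion S F \<longleftrightarrow> (\<exists>(n::nat) T.
    T 0 = {\<one>\<^bsub>S\<^esub>} \<and> T n = carrier S \<and>
    (\<forall>i\<le>n. strongly_closed S F (T i)) \<and>
    (\<forall>i<n. T i \<subseteq> T (Suc i) \<and> cyclic_group (subgrp S (T (Suc i)) Mod T i)))"

end

theory Submission
  imports Defs "HOL-Number_Theory.Residues"
begin

text \<open>
  Fusion in S is shown to be controlled by the normalizer of S. By Alperin's argument it suffices
  to factorize N(B) = C(B) N(T), where T is a Sylow subgroup of N(B) contained in S and B is a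
  subgroup of S with C(B) \<inter> S \<le> B. A centric B has order greater than |D|, since otherwise an
  abelian subgroup of order |D| or p|D| would properly contain B. Hence the 2-eternal property
  applies to N(B), and all chief factors of N(B) below P = O_p(N(B)) \<ge> B are cyclic, thus of
  order p. The elements of N(B) acting trivially on these chief factors form a normal subgroup K
  that contains T and whose p'-elements centralize P, so K = C(P) T, and the Frattini argument
  yields N(B) = C(P) N(T). For B = S the same property makes a chief series of N(S) below S have
  cyclic factors, and control of fusion makes its terms strongly closed.
\<close>

section \<open>Fixed points and conjugation\<close>

text \<open>The relation is given for subgroups of \<open>S\<close> relative to \<open>G\<close>,
  while the 2-eternal property concerns O_p of a group. Condition (0) passes the relation from
  \<open>G\<close> to N(B), so the property says something about N(B) once O_p(N(B)) lies in
  \<open>S\<close> and has order greater than |D|. Hence the interest in large B, and in Sylow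
  subgroups of N(B) that lie in \<open>S\<close>.

  Elements of p-power order act trivially on a chief factor of order p because the automorphism
  group of that factor has order p - 1. An element of order prime to p that acts trivially on all
  chief factors below P fixes P pointwise: it could only multiply an element of P by some z whose
  order is both a power of p and prime to p.

  In the factorization N(B) = C(P) N(T) the first factor does not affect fusion, since B \<le> P
  gives C(P) \<le> C(B). Only an element of N(T) is left, and T = S \<inter> N(B) is larger than B
  unless B = S, so an induction on the size of the conjugated subgroup can take over.\<close>

lemma p_group_action_fixed_points:
  assumes "group_action P E \<phi>" "finite E" "order P = p ^ n" "Factorial_Ring.prime p"
  shows "p dvd card E \<longleftrightarrow> p dvd card {x \<in> E. \<forall>g\<in>carrier P. \<phi> g x = x}"
proof -
  interpret group_action P E \<phi> by fact
  interpret P: group P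
    using group_hom group_hom.axioms(1) by blast
  define F where "F = {x \<in> E. \<forall>g\<in>carrier P. \<phi> g x = x}"
  \<comment> \<open>The points outside \<open>F\<close> are counted orbit by orbit. An orbit that
    meets \<open>F\<close> is a single fixed point and contributes 0; any other orbit has p-power
    size different from 1.\<close>
  have "p dvd (\<Sum>x\<in>A. if x \<in> F then 0 else 1::nat)" if A: "A \<in> orbits P E \<phi>" for A
  proof (cases "A \<inter> F = {}")
    case True
    obtain x where x: "x \<in> E" "A = orbit P \<phi> x"
      using A by (auto simp: orbits_def)
    have "card A dvd p ^ n"
      using orbit_stabilizer_theorem[OF x(1)] x(2) assms(3) by (metis dvd_triv_left)
    then obtain k where k: "card A = p ^ k"
      using assms(4) divides_primepow_nat by blast
    have xA: "x \<in> A"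
      using orbit_refl x by simp
    have "card A \<noteq> 1"
    proof
      assume "card A = 1"
      then have "A = {x}"
        using xA by (metis card_1_singletonE singletonD)
      then have "\<phi> g x = x" if "g \<in> carrier P" for g
        using x(2) that unfolding orbit_def by blast
      then show False
        using True xA x(1) F_def by blast
    qed
    then have "p dvd card A"
      using k by (cases k) auto
    moreover have "(\<Sum>x\<in>A. if x \<in> F then 0 else 1::nat) = (\<Sum>x\<in>A. 1)"
      using True by (intro sum.cong) auto
    ultimately show ?thesis by simp
  next
    case False
    then obtain y where y: "y \<in> A" "y \<in> F" by blast
    obtain x where x: "x \<in> E" "A = orbit P \<phi> x"
      using A by (auto simp: orbits_def)
    have "A = orbit P \<phi> y"
    proof -
      have "orbit P \<phi> y \<in> orbits P E \<phi>"
        using y(2) by (auto simp: orbits_def F_def)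
      moreover have "y \<in> orbit P \<phi> y"
        using y(2) orbit_refl F_def by blast
      ultimately show ?thesis
        using disjoint_union[OF A] y(1) by blast
    qed
    also have "\<dots> \<subseteq> {y}"
      using y(2) by (auto simp: orbit_def F_def)
    finally have "A \<subseteq> F" using y(2) by blast
    then have "(\<Sum>x\<in>A. if x \<in> F then 0 else 1::nat) = 0"
      by (auto intro!: sum.neutral)
    then show ?thesis by simp
  qed
  then have "p dvd (\<Sum>x\<in>E. if x \<in> F then 0 else 1::nat)"
    unfolding disjoint_sum[OF assms(2), symmetric] by (rule dvd_sum)
  also have "(\<Sum>x\<in>E. if x \<in> F then 0 else 1::nat) = card (E - F)"
    using assms(2) by (simp add: sum.If_cases Diff_eq)
  finally have "p dvd card (E - F)" .
  moreover have "card E = card (E - F) + card F"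
  proof -
    have "F \<subseteq> E" by (auto simp: F_def)
    then show ?thesis
      using assms(2) by (metis card_Diff_subset card_mono finite_subset le_add_diff_inverse2)
  qed
  ultimately show ?thesis
    unfolding F_def[symmetric] by (simp add: dvd_add_right_iff)
qed

locale finite_group = group G for G :: "'a monoid" (structure) +
  assumes finite_carrier [simp]: "finite (carrier G)"
begin

text \<open>The p-group \<open>Q\<close> acts on the right cosets of \<open>S\<close> by right
  multiplication, and the count of fixed points applies.\<close>

lemma coset_fixed_points:
  assumes Q: "subgroup Q G" and S: "subgroup S G"
    and card: "card Q = p ^ n" "Factorial_Ring.prime p"
  shows "p dvd card (rcosets S) \<longleftrightarrow> p dvd card {C \<in> rcosets S. \<forall>q\<in>Q. C #> q = C}"
proof -
  \<comment> \<open>The inverse turns right multiplication into a left action, as a homomorphism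
    into \<open>BijGroup\<close> demands; the restriction makes the maps extensional. As
    \<open>Q\<close> is closed under inverses, the fixed cosets are the same.\<close>
  define \<phi> where "\<phi> = (\<lambda>q. \<lambda>C\<in>rcosets S. C #> inv q)"
  have sub: "C \<subseteq> carrier G" if "C \<in> rcosets S" for C
    using that S rcosets_subset_PowG by blast
  have closed: "C #> q \<in> rcosets S" if "C \<in> rcosets S" "q \<in> carrier G" for C q
    using that S
    by (auto simp: RCOSETS_def subgroup.subset coset_mult_assoc intro!: bexI[of _ "_ \<otimes> q"])
  have bij: "\<phi> q \<in> Bij (rcosets S)" if q: "q \<in> carrier G" for q
  proof -
    have "bij_betw (\<phi> q) (rcosets S) (rcosets S)"
      by (rule bij_betw_byWitness[where f' = "\<lambda>C. C #> q"])
        (use q closed sub in \<open>auto simp: \<phi>_def coset_mult_assoc\<close>)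
    then show ?thesis
      by (simp add: Bij_def \<phi>_def)
  qed
  have "group_hom (subgrp G Q) (BijGroup (rcosets S)) \<phi>"
  proof (intro group_hom.intro group_hom_axioms.intro homI group_BijGroup)
    show "group (subgrp G Q)"
      using Q by (simp add: subgroup_imp_group)
    fix x assume "x \<in> carrier (subgrp G Q)"
    then have x: "x \<in> Q" "x \<in> carrier G"
      using Q subgroup.subset by auto
    show "\<phi> x \<in> carrier (BijGroup (rcosets S))"
      using bij x by (simp add: BijGroup_def)
    fix y assume "y \<in> carrier (subgrp G Q)"
    then have y: "y \<in> Q" "y \<in> carrier G"
      using Q subgroup.subset by auto
    have "\<phi> (x \<otimes> y) = compose (rcosets S) (\<phi> x) (\<phi> y)"
      using x y closed sub
      by (auto simp: \<phi>_def compose_def inv_mult_group coset_mult_assoc intro!: restrict_ext)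
    then show "\<phi> (x \<otimes>\<^bsub>subgrp G Q\<^esub> y) = \<phi> x \<otimes>\<^bsub>BijGroup (rcosets S)\<^esub> \<phi> y"
      using bij x y by (simp add: BijGroup_def)
  qed
  then have act: "group_action (subgrp G Q) (rcosets S) \<phi>"
    by (rule group_action.intro)
  have "finite (rcosets S)"
    using finite_carrier S rcosets_subset_PowG by (meson finite_Pow_iff finite_subset)
  note this
  moreover have "order (subgrp G Q) = p ^ n"
    using card by (simp add: order_def)
  ultimately have "p dvd card (rcosets S) \<longleftrightarrow>
      p dvd card {C \<in> rcosets S. \<forall>q\<in>carrier (subgrp G Q). \<phi> q C = C}"
    using p_group_action_fixed_points[OF act] card(2) by blast
  also have "{C \<in> rcosets S. \<forall>q\<in>carrier (subgrp G Q). \<phi> q C = C} =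
      {C \<in> rcosets S. \<forall>q\<in>Q. C #> q = C}"
    (is "?A = ?B")
  proof -
    have "(\<forall>q\<in>carrier (subgrp G Q). \<phi> q C = C) \<longleftrightarrow> (\<forall>q\<in>Q. C #> q = C)"
      if "C \<in> rcosets S" for C
      using that subgroup.mem_carrier[OF Q] subgroup.m_inv_closed[OF Q]
      by (simp add: \<phi>_def) (metis inv_inv)
    then show ?thesis by blast
  qed
  finally show ?thesis .
qed

text \<open>The convention x^g = g^-1 x g of \<open>fusion_system\<close>. It is a right action:
  conjugating by \<open>g\<close> and then by \<open>h\<close> is conjugating by
  \<open>g \<otimes> h\<close>.\<close>

definition conj_by :: "'a \<Rightarrow> 'a \<Rightarrow> 'a"
  where "conj_by g x = inv g \<otimes> x \<otimes> g"

lemma conj_by_closed [simp, intro]: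
  "\<lbrakk>g \<in> carrier G; x \<in> carrier G\<rbrakk> \<Longrightarrow> conj_by g x \<in> carrier G"
  by (simp add: conj_by_def)

lemma conj_by_mult:
  "\<lbrakk>g \<in> carrier G; x \<in> carrier G; y \<in> carrier G\<rbrakk> \<Longrightarrow>
    conj_by g (x \<otimes> y) = conj_by g x \<otimes> conj_by g y"
  by (simp add: conj_by_def m_assoc flip: m_assoc[of g "inv g"])

lemma conj_by_one [simp]: "g \<in> carrier G \<Longrightarrow> conj_by g \<one> = \<one>"
  by (simp add: conj_by_def)

lemma conj_by_id [simp]: "x \<in> carrier G \<Longrightarrow> conj_by \<one> x = x"
  by (simp add: conj_by_def)

lemma conj_by_inv:
  "\<lbrakk>g \<in> carrier G; x \<in> carrier G\<rbrakk> \<Longrightarrow> conj_by g (inv x) = inv (conj_by g x)"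
  by (simp add: conj_by_def inv_mult_group m_assoc)

lemma conj_by_conj_by:
  "\<lbrakk>g \<in> carrier G; h \<in> carrier G; x \<in> carrier G\<rbrakk> \<Longrightarrow>
    conj_by h (conj_by g x) = conj_by (g \<otimes> h) x"
  by (simp add: conj_by_def inv_mult_group m_assoc)

lemma conj_by_inv_cancel [simp]:
  "\<lbrakk>g \<in> carrier G; x \<in> carrier G\<rbrakk> \<Longrightarrow> conj_by (inv g) (conj_by g x) = x"
  "\<lbrakk>g \<in> carrier G; x \<in> carrier G\<rbrakk> \<Longrightarrow> conj_by g (conj_by (inv g) x) = x"
  by (simp_all add: conj_by_conj_by)

lemma conj_by_inj: "\<lbrakk>g \<in> carrier G; A \<subseteq> carrier G\<rbrakk> \<Longrightarrow> inj_on (conj_by g) A"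
  by (rule inj_on_inverseI[where g = "conj_by (inv g)"]) auto

lemma conj_by_pow:
  "\<lbrakk>g \<in> carrier G; x \<in> carrier G\<rbrakk> \<Longrightarrow> conj_by g (x [^] (n::nat)) = conj_by g x [^] n"
  by (induction n) (auto simp: conj_by_mult)

lemma conj_by_eq_iff:
  "\<lbrakk>g \<in> carrier G; x \<in> carrier G\<rbrakk> \<Longrightarrow> conj_by g x = x \<longleftrightarrow> x \<otimes> g = g \<otimes> x"
  by (metis conj_by_def inv_closed inv_solve_left m_assoc m_closed)

lemma image_conj_by_conj_by:
  assumes "g \<in> carrier G" "h \<in> carrier G" "A \<subseteq> carrier G"
  shows "conj_by h ` conj_by g ` A = conj_by (g \<otimes> h) ` A"
  unfolding image_image using assms by (intro image_cong) (auto simp: conj_by_conj_by)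

lemma image_conj_by_id: "A \<subseteq> carrier G \<Longrightarrow> conj_by \<one> ` A = A"
  by (metis (no_types, lifting) conj_by_id image_cong image_ident subsetD)

lemma image_conj_by_inv:
  assumes "g \<in> carrier G" "A \<subseteq> carrier G" "conj_by g ` A = B"
  shows "conj_by (inv g) ` B = A"
  using assms by (simp add: image_conj_by_conj_by image_conj_by_id flip: assms(3))

lemma subgroup_conj_by:
  assumes g: "g \<in> carrier G" and A: "subgroup A G"
  shows "subgroup (conj_by g ` A) G"
proof (rule subgroupI)
  note sub = subgroup.subset[OF A]
  show "conj_by g ` A \<subseteq> carrier G" using g sub by auto
  show "conj_by g ` A \<noteq> {}" using subgroup.one_closed[OF A] by blast
  fix a assume "a \<in> conj_by g ` A"
  then obtain x where x: "x \<in> A" "a = conj_by g x" by blast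
  show "inv a \<in> conj_by g ` A"
    using x g sub subgroup.m_inv_closed[OF A x(1)] conj_by_inv[OF g, of x] by (metis imageI subsetD)
  fix b assume "b \<in> conj_by g ` A"
  then obtain y where y: "y \<in> A" "b = conj_by g y" by blast
  show "a \<otimes> b \<in> conj_by g ` A"
    using x y g sub subgroup.m_closed[OF A x(1) y(1)] conj_by_mult[OF g, of x y]
    by (metis imageI subsetD)
qed

lemma card_conj_by: "\<lbrakk>g \<in> carrier G; A \<subseteq> carrier G\<rbrakk> \<Longrightarrow> card (conj_by g ` A) = card A"
  by (simp add: card_image conj_by_inj)

lemma conj_by_subgroup:
  assumes "subgroup A G" "x \<in> A"
  shows "conj_by x ` A = A"
proof -
  have sub: "conj_by y ` A \<subseteq> A" if "y \<in> A" for y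
    using that assms(1) by (auto simp: conj_by_def subgroup.m_closed subgroup.m_inv_closed)
  have x: "x \<in> carrier G" using assms subgroup.mem_carrier by metis
  have "conj_by x ` conj_by (inv x) ` A \<subseteq> conj_by x ` A"
    by (intro image_mono sub subgroup.m_inv_closed[OF assms])
  then have "A \<subseteq> conj_by x ` A"
    using x subgroup.subset[OF assms(1)] by (simp add: image_conj_by_conj_by image_conj_by_id)
  then show ?thesis
    using sub[OF assms(2)] by blast
qed

text \<open>Subgroups such as normalizers are studied as finite groups of their own by interpreting
  the locale at \<open>subgrp G N\<close>. The lemmas that relate notions of
  \<open>subgrp G N\<close> to those of \<open>G\<close> carry results back.\<close>

lemma finite_group_subgrp: "subgroup N G \<Longrightarrow> finite_group (subgrp G N)"
  by (simp add: finite_group.intro finite_group_axioms.intro subgroup_imp_group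
      finite_subset[OF subgroup.subset])

lemma conj_by_subgrp:
  assumes "subgroup N G" "n \<in> N"
  shows "finite_group.conj_by (subgrp G N) n x = conj_by n x"
  using assms by (simp add: finite_group.conj_by_def[OF finite_group_subgrp] conj_by_def)

end

section \<open>Sylow subgroups\<close>

context finite_group
begin

definition normalizer_of :: "'a set \<Rightarrow> 'a set"
  where "normalizer_of A = {g \<in> carrier G. conj_by g ` A = A}"

definition centralizer_of :: "'a set \<Rightarrow> 'a set"
  where "centralizer_of A = {g \<in> carrier G. \<forall>a\<in>A. conj_by g a = a}"

lemma subgroup_normalizer_of:
  assumes "A \<subseteq> carrier G"
  shows "subgroup (normalizer_of A) G"
proof (rule subgroupI)
  show "normalizer_of A \<noteq> {}"
    using image_conj_by_id[OF assms] by (auto simp: normalizer_of_def)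
  fix g assume g: "g \<in> normalizer_of A"
  then show "inv g \<in> normalizer_of A"
    using image_conj_by_inv[of g A A] assms by (auto simp: normalizer_of_def)
  fix h assume "h \<in> normalizer_of A"
  then show "g \<otimes> h \<in> normalizer_of A"
    using g assms image_conj_by_conj_by[of g h A] by (auto simp: normalizer_of_def)
qed (auto simp: normalizer_of_def)

lemma subgroup_centralizer_of:
  assumes "A \<subseteq> carrier G"
  shows "subgroup (centralizer_of A) G"
proof (rule subgroupI)
  show "centralizer_of A \<noteq> {}"
    using assms by (auto simp: centralizer_of_def intro!: exI[of _ \<one>])
  fix g assume g: "g \<in> centralizer_of A"
  then have "conj_by (inv g) a = a" if "a \<in> A" for a
    using that assms conj_by_inv_cancel(1)[of g a] by (auto simp: centralizer_of_def)
  then show "inv g \<in> centralizer_of A"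
    using g by (auto simp: centralizer_of_def)
  fix h assume "h \<in> centralizer_of A"
  then show "g \<otimes> h \<in> centralizer_of A"
    using g assms by (auto simp: centralizer_of_def subset_eq simp flip: conj_by_conj_by)
qed (auto simp: centralizer_of_def)

lemma subgroup_subset_normalizer_of: "subgroup A G \<Longrightarrow> A \<subseteq> normalizer_of A"
  using conj_by_subgroup subgroup.mem_carrier by (fastforce simp: normalizer_of_def)

lemma finite_subset_carrier: "A \<subseteq> carrier G \<Longrightarrow> finite A"
  using finite_carrier finite_subset by blast

lemma conj_by_subset_eq:
  assumes "g \<in> carrier G" "A \<subseteq> carrier G" "conj_by g ` A \<subseteq> A"
  shows "conj_by g ` A = A"
  using assms by (intro card_subset_eq) (auto simp: finite_subset_carrier card_conj_by)

lemma card_subgroup_dvd: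
  assumes "subgroup A G" "subgroup B G" "A \<subseteq> B"
  shows "card A dvd card B"
proof -
  interpret B: group "subgrp G B" using assms(2) by (rule subgroup_imp_group)
  have "card (rcosets\<^bsub>subgrp G B\<^esub> A) * card A = card B"
    using B.lagrange[OF subgroup_incl[OF assms]] by (simp add: order_def)
  then show ?thesis by (metis dvd_triv_right)
qed

lemma card_subgroup_pos: "subgroup A G \<Longrightarrow> 0 < card A"
  using finite_subset_carrier subgroup.subset subgroup.one_closed card_gt_0_iff by blast

section \<open>Subgroups of prime power order\<close>

definition p_subgroup :: "nat \<Rightarrow> 'a set \<Rightarrow> bool"
  where "p_subgroup p Q \<longleftrightarrow> subgroup Q G \<and> (\<exists>n. card Q = p ^ n)"

lemma p_subgroup_subset:
  assumes "Factorial_Ring.prime p" "p_subgroup p Q" "subgroup A G" "A \<subseteq> Q"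
  shows "p_subgroup p A"
  using assms card_subgroup_dvd[of A Q] divides_primepow_nat unfolding p_subgroup_def by metis

lemma p_subgroup_conj_by:
  "g \<in> carrier G \<Longrightarrow> p_subgroup p Q \<Longrightarrow> p_subgroup p (conj_by g ` Q)"
  by (auto simp: p_subgroup_def subgroup_conj_by card_conj_by subgroup.subset)

lemma p_subgroup_subgrp:
  assumes "subgroup N G"
  shows "finite_group.p_subgroup (subgrp G N) p Q \<longleftrightarrow> p_subgroup p Q \<and> Q \<subseteq> N"
proof -
  have "subgroup Q (subgrp G N) \<longleftrightarrow> subgroup Q G \<and> Q \<subseteq> N"
    using incl_subgroup[OF assms] subgroup_incl[OF _ assms] subgroup.subset[of Q "subgrp G N"]
    by auto
  then show ?thesis
    unfolding finite_group.p_subgroup_def[OF finite_group_subgrp[OF assms]] p_subgroup_def by blast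
qed

text \<open>The number of cosets of \<open>S\<close> is prime to p, so \<open>Q\<close> fixes some
  coset Sg. Then Sgq = Sg for every q in \<open>Q\<close>, that is, g q g^-1 lies in
  \<open>S\<close>; the conjugating element is \<open>inv g\<close>.\<close>

lemma p_subgroup_conj_into:
  assumes p: "Factorial_Ring.prime p" and Q: "p_subgroup p Q"
    and S: "subgroup S G" and index: "\<not> p dvd card (rcosets S)"
  shows "\<exists>g\<in>carrier G. conj_by g ` Q \<subseteq> S"
proof -
  obtain n where "subgroup Q G" "card Q = p ^ n"
    using Q by (auto simp: p_subgroup_def)
  then have "\<not> p dvd card {C \<in> rcosets S. \<forall>q\<in>Q. C #> q = C}"
    using coset_fixed_points p S index by blast
  then have "{C \<in> rcosets S. \<forall>q\<in>Q. C #> q = C} \<noteq> {}"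
    by (metis card.empty dvd_0_right)
  then obtain C where C: "C \<in> rcosets S" "\<forall>q\<in>Q. C #> q = C" by blast
  then obtain g where g: "g \<in> carrier G" "C = S #> g" by (auto simp: RCOSETS_def)
  have "conj_by (inv g) q \<in> S" if "q \<in> Q" for q
  proof -
    have q: "q \<in> carrier G" using that \<open>subgroup Q G\<close> subgroup.mem_carrier by metis
    have "S #> (g \<otimes> q) = S #> g"
      using C(2) g q that coset_mult_assoc[OF subgroup.subset[OF S] g(1) q] by simp
    then have "g \<otimes> q \<in> S #> g"
      using rcos_self[OF _ S, of "g \<otimes> q"] g q by simp
    then show ?thesis
    proof -
      obtain x where x: "x \<in> S" "g \<otimes> q = x \<otimes> g"
        using \<open>g \<otimes> q \<in> S #> g\<close> by (auto simp: r_coset_def)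
      then have "conj_by (inv g) q = x"
        using g q subgroup.mem_carrier[OF S x(1)] by (simp add: conj_by_def m_assoc)
      then show ?thesis using x(1) by simp
    qed
  qed
  then show ?thesis using g by blast
qed

(* Containment up to conjugacy replaces the condition on orders: it passes directly to conjugates. *)
definition sylow_in :: "nat \<Rightarrow> 'a set \<Rightarrow> 'a set \<Rightarrow> bool"
  where "sylow_in p N T \<longleftrightarrow> p_subgroup p T \<and> T \<subseteq> N \<and>
    (\<forall>Q. p_subgroup p Q \<and> Q \<subseteq> N \<longrightarrow> (\<exists>g\<in>N. conj_by g ` Q \<subseteq> T))"

lemma sylow_subgroup_sylow_in:
  assumes p: "Factorial_Ring.prime p" and S: "sylow_subgroup p G S"
  shows "sylow_in p (carrier G) S"
proof -
  have S': "subgroup S G" "card S = p ^ multiplicity p (order G)"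
    using S by (auto simp: sylow_subgroup_def)
  have "order G \<noteq> 0" by (simp add: order_gt_0_iff_finite)
  then have "\<not> p dvd card (rcosets S)"
    using lagrange[OF S'(1)] S'(2) p multiplicity_decompose[of "order G" p]
    by (metis dvd_div_mult_self multiplicity_dvd nonzero_mult_div_cancel_right not_prime_unit
        mult_is_0)
  then show ?thesis
    using p_subgroup_conj_into[OF p _ S'(1)] S'(2) S'(1) subgroup.subset[OF S'(1)]
    by (auto simp: sylow_in_def p_subgroup_def)
qed

lemma sylow_in_exists:
  assumes p: "Factorial_Ring.prime p" and N: "subgroup N G"
  shows "\<exists>T. sylow_in p N T"
proof -
  interpret N: finite_group "subgrp G N" using N by (rule finite_group_subgrp)
  obtain m where "order (subgrp G N) = p ^ multiplicity p (order (subgrp G N)) * m"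
    using multiplicity_dvd by (metis dvdE)
  then obtain T where "subgroup T (subgrp G N)"
      "card T = p ^ multiplicity p (order (subgrp G N))"
    using Sylow.sylow_thm[OF p N.group_axioms _ N.finite_carrier] by blast
  then have "N.sylow_in p (carrier (subgrp G N)) T"
    by (intro N.sylow_subgroup_sylow_in p) (simp add: sylow_subgroup_def)
  then have "sylow_in p N T"
    using N unfolding N.sylow_in_def sylow_in_def
    by (auto simp: p_subgroup_subgrp conj_by_subgrp cong: image_cong)
  then show ?thesis ..
qed

lemma sylow_in_conj_by:
  assumes T: "sylow_in p N T" and g: "g \<in> carrier G" and N: "subgroup N G"
  shows "sylow_in p (conj_by g ` N) (conj_by g ` T)"
  unfolding sylow_in_def
proof (intro conjI allI impI)
  show "p_subgroup p (conj_by g ` T)" "conj_by g ` T \<subseteq> conj_by g ` N"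
    using T g p_subgroup_conj_by by (auto simp: sylow_in_def)
  fix Q assume Q: "p_subgroup p Q \<and> Q \<subseteq> conj_by g ` N"
  have NG: "N \<subseteq> carrier G" using N by (rule subgroup.subset)
  have QG: "Q \<subseteq> carrier G" using Q by (auto simp: p_subgroup_def dest: subgroup.subset)
  have "conj_by (inv g) ` Q \<subseteq> conj_by (inv g) ` conj_by g ` N"
    using Q by (intro image_mono) auto
  also have "\<dots> = N" using g NG by (simp add: image_conj_by_inv)
  finally have "p_subgroup p (conj_by (inv g) ` Q) \<and> conj_by (inv g) ` Q \<subseteq> N"
    using Q g p_subgroup_conj_by by auto
  then obtain n where n: "n \<in> N" "conj_by n ` conj_by (inv g) ` Q \<subseteq> T"
    using T unfolding sylow_in_def by blast
  have nG: "n \<in> carrier G" using n NG by blast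
  have "conj_by (conj_by g n) ` Q = conj_by g ` conj_by n ` conj_by (inv g) ` Q"
    unfolding image_image using g nG QG
    by (intro image_cong) (auto simp: conj_by_def inv_mult_group m_assoc subset_iff)
  also have "\<dots> \<subseteq> conj_by g ` T" using n by blast
  finally show "\<exists>h\<in>conj_by g ` N. conj_by h ` Q \<subseteq> conj_by g ` T"
    using n(1) by blast
qed

lemma sylow_in_maximal:
  assumes "sylow_in p N T" "p_subgroup p Q" "Q \<subseteq> N" "T \<subseteq> Q" "subgroup N G"
  shows "Q = T"
proof -
  obtain g where g: "g \<in> N" "conj_by g ` Q \<subseteq> T"
    using assms by (auto simp: sylow_in_def)
  have sub: "Q \<subseteq> carrier G" "g \<in> carrier G" "finite Q"
    using assms g subgroup.subset[of Q G] subgroup.subset[of N G] finite_subset_carrier[of Q]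
    by (auto simp: p_subgroup_def)
  then have "card Q \<le> card T"
    using g(2) card_conj_by[of g Q] assms(4) by (metis card_mono finite_subset)
  then show ?thesis
    using assms(4) sub(3) card_seteq by blast
qed

text \<open>A Sylow subgroup T0 of \<open>M\<close> can be moved into \<open>T\<close> by an element
  of \<open>N\<close>, and it stays inside the invariant \<open>M\<close>. So T \<inter> M is at
  least as large as T0. Being a p-subgroup of \<open>M\<close>, it is also moved into T0 by an
  element of \<open>M\<close>; so it is an \<open>M\<close>-conjugate of T0.\<close>

lemma sylow_in_normal:
  assumes p: "Factorial_Ring.prime p" and T: "sylow_in p N T"
    and N: "subgroup N G" and M: "subgroup M G" "M \<subseteq> N"
    and nrm: "\<And>n. n \<in> N \<Longrightarrow> conj_by n ` M = M"
  shows "sylow_in p M (T \<inter> M)"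
proof -
  obtain T0 where T0: "sylow_in p M T0" using sylow_in_exists p M by blast
  have pT: "p_subgroup p T" and pT0: "p_subgroup p T0" "T0 \<subseteq> M"
    using T T0 by (auto simp: sylow_in_def)
  have sub: "N \<subseteq> carrier G" "M \<subseteq> carrier G" "T0 \<subseteq> carrier G" "T \<subseteq> carrier G"
    using N M pT pT0 by (auto simp: p_subgroup_def dest: subgroup.subset)
  obtain n where n: "n \<in> N" "conj_by n ` T0 \<subseteq> T"
    using T T0 M(2) unfolding sylow_in_def by blast
  have nG: "n \<in> carrier G" using n sub by blast
  have n': "conj_by n ` T0 \<subseteq> T \<inter> M"
    using n nrm[OF n(1)] pT0(2) by blast
  have pTM: "p_subgroup p (T \<inter> M)"
    using p_subgroup_subset[OF p pT] pT M subgroups_Inter_pair by (auto simp: p_subgroup_def)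
  then obtain m where m: "m \<in> M" "conj_by m ` (T \<inter> M) \<subseteq> T0"
    using T0 unfolding sylow_in_def by blast
  have mG: "m \<in> carrier G" using m sub by blast
  have "card T0 \<le> card (T \<inter> M)"
    using n' card_conj_by[OF nG sub(3)] sub by (metis card_mono finite_Int finite_subset_carrier)
  then have "conj_by m ` (T \<inter> M) = T0"
    using m(2) card_conj_by[OF mG, of "T \<inter> M"] sub
    by (intro card_seteq) (simp_all add: finite_subset_carrier le_infI1)
  then have eq: "conj_by (inv m) ` T0 = T \<inter> M"
    using image_conj_by_inv[OF mG, of "T \<inter> M"] sub by auto
  have "sylow_in p (conj_by (inv m) ` M) (conj_by (inv m) ` T0)"
    using sylow_in_conj_by[OF T0 _ M(1)] mG by simp
  then show ?thesis
    using eq conj_by_subgroup[OF M(1) subgroup.m_inv_closed[OF M(1) m(1)]] by simp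
qed

text \<open>\<open>h\<close> moves \<open>T\<close> to another p-subgroup of \<open>M\<close>, and
  some m in \<open>M\<close> brings it back. So h m normalizes \<open>T\<close>, and h = (h m^-1
  h^-1)(h m) with the first factor in \<open>M\<close>.\<close>

lemma frattini:
  assumes T: "sylow_in p M T" and M: "subgroup M G" and h: "h \<in> normalizer_of M"
  shows "\<exists>m\<in>M. \<exists>j\<in>normalizer_of T. h = m \<otimes> j"
proof -
  have pT: "p_subgroup p T" "T \<subseteq> M" using T by (auto simp: sylow_in_def)
  have sub: "M \<subseteq> carrier G" "T \<subseteq> carrier G" using M pT subgroup.subset by auto
  have hG: "h \<in> carrier G" and hM: "conj_by h ` M = M"
    using h by (auto simp: normalizer_of_def)
  have "p_subgroup p (conj_by h ` T)" "conj_by h ` T \<subseteq> M"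
    using pT(1) p_subgroup_conj_by hG image_mono[OF pT(2), of "conj_by h"] hM by auto
  then obtain m where m: "m \<in> M" "conj_by m ` conj_by h ` T \<subseteq> T"
    using T unfolding sylow_in_def by blast
  have mG: "m \<in> carrier G" using m sub by blast
  have "conj_by (h \<otimes> m) ` T = T"
    using m(2) conj_by_subset_eq[of "h \<otimes> m" T] sub hG mG by (simp add: image_conj_by_conj_by)
  then have j: "h \<otimes> m \<in> normalizer_of T" using hG mG by (simp add: normalizer_of_def)
  have "conj_by (inv h) ` M = M"
    using image_conj_by_inv[OF hG sub(1) hM] .
  moreover have "inv m \<in> M" using M m by (simp add: subgroup.m_inv_closed)
  ultimately have "conj_by (inv h) (inv m) \<in> M" by blast
  moreover have "h = conj_by (inv h) (inv m) \<otimes> (h \<otimes> m)"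
    using hG mG by (simp add: conj_by_def m_assoc)
      (simp flip: m_assoc)
  ultimately show ?thesis using j by blast
qed

text \<open>\<open>B\<close> acts on its own cosets by right multiplication. The index of the proper
  subgroup \<open>B\<close> is divisible by p, hence so is the number of fixed cosets, which is the
  order of N(B)/B. A subgroup of order p of this quotient is pulled back to N(B).\<close>

lemma p_group_normalizer_step:
  assumes p: "Factorial_Ring.prime p" and G: "order G = p ^ n"
    and B: "subgroup B G" "B \<noteq> carrier G"
  shows "\<exists>H. subgroup H G \<and> B \<subseteq> H \<and> H \<subseteq> normalizer_of B \<and> card H = p * card B"
proof -
  define M where "M = normalizer_of B"
  have BG: "B \<subseteq> carrier G" using B subgroup.subset by blast
  have M: "subgroup M G" unfolding M_def using subgroup_normalizer_of BG .
  have BM: "B \<subseteq> M" unfolding M_def using subgroup_subset_normalizer_of B(1) .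
  interpret M: finite_group "subgrp G M" using M by (rule finite_group_subgrp)
  have BsM: "subgroup B (subgrp G M)" using subgroup_incl B M BM by blast
  have BnM: "B \<lhd> subgrp G M"
    unfolding M.normal_inv_iff
  proof (intro conjI BsM ballI)
    fix x h assume x: "x \<in> carrier (subgrp G M)" and h: "h \<in> B"
    then have "conj_by (inv x) h \<in> B"
      using subgroup.m_inv_closed[OF M, of x] by (auto simp: M_def normalizer_of_def)
    then show "x \<otimes>\<^bsub>subgrp G M\<^esub> h \<otimes>\<^bsub>subgrp G M\<^esub> inv\<^bsub>subgrp G M\<^esub> x \<in> B"
      using x M subgroup.mem_carrier[OF M, of x] by (simp add: conj_by_def)
  qed
  interpret B: normal B "subgrp G M" by fact
  have "p dvd card (rcosets B)"
  proof -
    have "card (rcosets B) dvd p ^ n"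
      using lagrange[OF B(1)] G by (metis dvd_triv_left)
    then obtain k where k: "card (rcosets B) = p ^ k"
      using p divides_primepow_nat by blast
    have "card (rcosets B) \<noteq> 1"
    proof
      assume "card (rcosets B) = 1"
      then have "card B = card (carrier G)" using lagrange[OF B(1)] by (simp add: order_def)
      then show False using B(2) BG card_subset_eq[OF finite_carrier BG] by blast
    qed
    then show ?thesis using k by (cases k) auto
  qed
  moreover obtain k where "card B = p ^ k"
    using lagrange[OF B(1)] G p divides_primepow_nat by (metis dvd_triv_right)
  ultimately have "p dvd card {C \<in> rcosets B. \<forall>b\<in>B. C #> b = C}"
    using coset_fixed_points[OF B(1) B(1)] p by blast
  \<comment> \<open>Bgb = Bg means g b g^-1 \<in> B; so the coset Bg is fixed by all of
    \<open>B\<close> exactly when g normalizes \<open>B\<close>.\<close>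
  also have "{C \<in> rcosets B. \<forall>b\<in>B. C #> b = C} = rcosets\<^bsub>subgrp G M\<^esub> B"
  proof -
    have "(\<forall>b\<in>B. (B #> g) #> b = B #> g) \<longleftrightarrow> g \<in> M" if g: "g \<in> carrier G" for g
    proof -
      have "(B #> g) #> b = B #> g \<longleftrightarrow> conj_by (inv g) b \<in> B" if b: "b \<in> B" for b
      proof -
        have bG: "b \<in> carrier G" using b BG by blast
        have "(B #> g) #> b = B #> g \<longleftrightarrow> g \<otimes> b \<in> B #> g"
          using g bG BG B(1) repr_independence[of "g \<otimes> b" B g] rcos_self[of "g \<otimes> b" B]
          by (auto simp: coset_mult_assoc)
        also have "\<dots> \<longleftrightarrow> conj_by (inv g) b \<in> B"
        proof
          assume "g \<otimes> b \<in> B #> g"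
          then show "conj_by (inv g) b \<in> B"
            using g BG by (auto simp: r_coset_def conj_by_def m_assoc subset_iff)
        next
          assume "conj_by (inv g) b \<in> B"
          then have "conj_by (inv g) b \<otimes> g \<in> B #> g" using BG g by (simp add: rcosI)
          then show "g \<otimes> b \<in> B #> g" using g bG by (simp add: conj_by_def m_assoc)
        qed
        finally show ?thesis .
      qed
      then have "(\<forall>b\<in>B. (B #> g) #> b = B #> g) \<longleftrightarrow> conj_by (inv g) ` B \<subseteq> B" by blast
      also have "\<dots> \<longleftrightarrow> inv g \<in> M"
        using conj_by_subset_eq[of "inv g" B] g BG by (auto simp: M_def normalizer_of_def)
      also have "\<dots> \<longleftrightarrow> g \<in> M"
        using g subgroup.m_inv_closed[OF M] inv_inv by metis
      finally show ?thesis .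
    qed
    moreover have "rcosets\<^bsub>subgrp G M\<^esub> B = (\<lambda>g. B #> g) ` M"
      by (auto simp: RCOSETS_def r_coset_def)
    moreover have "rcosets B = (\<lambda>g. B #> g) ` carrier G"
      by (auto simp: RCOSETS_def)
    ultimately show ?thesis
      using subgroup.subset[OF M] by (auto simp del: coset_mult_assoc) blast+
  qed
  finally have "p dvd card (rcosets\<^bsub>subgrp G M\<^esub> B)" .
  \<comment> \<open>The existence part of Sylow's theorem is used with exponent 1, where
    \<open>m\<close> may still be divisible by p. It yields a subgroup of order p of the quotient;
    the union of its cosets is the preimage in \<open>M\<close>.\<close>
  then obtain m where "order (subgrp G M Mod B) = p ^ 1 * m"
    by (auto simp: order_def FactGroup_def dvd_def)
  moreover have "finite (carrier (subgrp G M Mod B))"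
    using M.rcosets_subset_PowG[OF BsM] finite_subset[of _ "Pow M"] finite_subset_carrier[OF subgroup.subset[OF M]]
    by (simp add: FactGroup_def)
  ultimately obtain Y where Y: "subgroup Y (subgrp G M Mod B)" "card Y = p ^ 1"
    using Sylow.sylow_thm[OF p B.factorgroup_is_group] by blast
  have H: "subgroup (\<Union>Y) (subgrp G M)"
    using B.factgroup_subgroup_union_subgroup Y by blast
  have Ysub: "Y \<subseteq> rcosets\<^bsub>subgrp G M\<^esub> B"
    using subgroup.subset[OF Y(1)] by (simp add: FactGroup_def)
  have "B \<in> Y"
    using subgroup.one_closed[OF Y(1)] by (simp add: FactGroup_def)
  have "card B * card Y = card (\<Union>Y)"
  proof (rule card_partition)
    show "finite (\<Union>Y)" using subgroup.subset[OF H] by (metis M.finite_carrier finite_subset)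
    then show "finite Y" by (rule finite_UnionD)
    show "card c = card B" if "c \<in> Y" for c
      using that Ysub M.card_rcosets_equal[OF _ subgroup.subset[OF BsM]] by auto
    show "c \<inter> d = {}" if "c \<in> Y" "d \<in> Y" "c \<noteq> d" for c d
      using that Ysub M.rcos_disjoint[OF BsM] unfolding pairwise_def disjnt_def by blast
  qed
  then have "card (\<Union>Y) = p * card B" using Y(2) by (simp add: mult.commute)
  moreover have "subgroup (\<Union>Y) G" using incl_subgroup[OF M H] .
  moreover have "\<Union>Y \<subseteq> M" using subgroup.subset[OF H] by simp
  ultimately show ?thesis
    using Union_upper[OF \<open>B \<in> Y\<close>] M_def by metis
qed

lemma normalizer_of_subgrp:
  assumes "subgroup N G" "A \<subseteq> N"
  shows "finite_group.normalizer_of (subgrp G N) A = normalizer_of A \<inter> N"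
  using assms subgroup.mem_carrier[OF assms(1)]
  by (auto simp: finite_group.normalizer_of_def[OF finite_group_subgrp] normalizer_of_def
      conj_by_subgrp)

lemma p_subgroup_normalizer_step:
  assumes p: "Factorial_Ring.prime p" and S: "p_subgroup p S"
    and B: "subgroup B G" "B \<subset> S"
  shows "\<exists>H. subgroup H G \<and> B \<subseteq> H \<and> H \<subseteq> S \<and> H \<subseteq> normalizer_of B \<and> card H = p * card B"
proof -
  obtain n where S': "subgroup S G" "card S = p ^ n" using S by (auto simp: p_subgroup_def)
  interpret S: finite_group "subgrp G S" using S'(1) by (rule finite_group_subgrp)
  obtain H where "subgroup H (subgrp G S)" "B \<subseteq> H" "H \<subseteq> S.normalizer_of B" "card H = p * card B"
    using S.p_group_normalizer_step[OF p, of n B] S' B subgroup_incl[OF B(1) S'(1)]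
    by (auto simp: order_def)
  then show ?thesis
    using incl_subgroup[OF S'(1)] normalizer_of_subgrp[OF S'(1), of B] B by auto
qed

text \<open>\<open>B\<close> grows inside \<open>S\<close> by a factor p at a time, so every power
  of p between the two orders is attained. The induction runs over the exponent of |B|, downwards
  from \<open>d\<close>.\<close>

lemma p_subgroup_intermediate:
  assumes p: "Factorial_Ring.prime p" and S: "p_subgroup p S"
    and B: "subgroup B G" "B \<subseteq> S" and d: "card B \<le> p ^ d" "p ^ d \<le> card S"
  shows "\<exists>H. subgroup H G \<and> B \<subseteq> H \<and> H \<subseteq> S \<and> card H = p ^ d"
proof -
  have "p_subgroup p B" using p_subgroup_subset p S B by blast
  then obtain k where k: "card B = p ^ k" by (auto simp: p_subgroup_def)
  have "k \<le> d" using d(1) k p by (simp add: power_le_imp_le_exp[OF prime_gt_1_nat])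
  then show ?thesis
    using B k d(2)
  proof (induction arbitrary: B rule: inc_induct)
    case base
    then show ?case by blast
  next
    case (step k)
    have "p ^ k < p ^ d" using step.hyps power_strict_increasing[OF _ prime_gt_1_nat[OF p]] by blast
    then have "B \<subset> S" using step.prems by auto
    then obtain H where "subgroup H G" "B \<subseteq> H" "H \<subseteq> S" "card H = p * card B"
      using p_subgroup_normalizer_step[OF p S] step.prems by blast
    moreover from this obtain L where "subgroup L G" "H \<subseteq> L" "L \<subseteq> S" "card L = p ^ d"
      using step.IH[of H] step.prems by auto
    ultimately show ?case by blast
  qed
qed

end

section \<open>The p-core and the supersolvable hypercenter\<close>

text \<open>\<open>GREATEST\<close> is a definite description and only meaningful if a greatest
  element exists. In a finite nonempty directed family a maximal member is the greatest one. For
  \<open>p_core\<close> and \<open>supersolvable_hypercenter\<close> the upper bounds are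
  products.\<close>

lemma Greatest_directed:
  assumes fin: "finite U" and sub: "\<And>A. Q A \<Longrightarrow> A \<subseteq> U" and ex: "Q A0"
    and dir: "\<And>A B. Q A \<Longrightarrow> Q B \<Longrightarrow> \<exists>C. Q C \<and> A \<subseteq> C \<and> B \<subseteq> C"
  shows "Q (Greatest Q)" and "Q A \<Longrightarrow> A \<subseteq> Greatest Q"
proof -
  have "finite {A. Q A}"
    using fin sub by (metis finite_Pow_iff finite_subset mem_Collect_eq Pow_iff subsetI)
  then obtain M where M: "Q M" "\<And>A. Q A \<Longrightarrow> M \<subseteq> A \<Longrightarrow> A = M"
    using finite_has_maximal[of "{A. Q A}"] ex by auto
  have max: "A \<subseteq> M" if "Q A" for A
    using dir[OF M(1) that] M(2) by blast
  have "Greatest Q = M"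
    using M(1) max by (rule Greatest_equality)
  then show "Q (Greatest Q)" "Q A \<Longrightarrow> A \<subseteq> Greatest Q"
    using M(1) max by auto
qed

context finite_group
begin

lemma normal_iff_conj_by:
  "A \<lhd> G \<longleftrightarrow> subgroup A G \<and> (\<forall>g\<in>carrier G. conj_by g ` A = A)"
proof (intro iffI conjI ballI; (elim conjE)?)
  assume A: "A \<lhd> G"
  then show sA: "subgroup A G" by (rule normal_imp_subgroup)
  fix g assume g: "g \<in> carrier G"
  show "conj_by g ` A = A"
  proof (rule conj_by_subset_eq[OF g subgroup.subset[OF sA]])
    show "conj_by g ` A \<subseteq> A"
      using normal.inv_op_closed1[OF A g] by (auto simp: conj_by_def)
  qed
next
  assume A: "subgroup A G" "\<forall>g\<in>carrier G. conj_by g ` A = A"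
  have "g \<otimes> a \<otimes> inv g \<in> A" if "g \<in> carrier G" "a \<in> A" for g a
  proof -
    have "conj_by (inv g) a \<in> A" using A(2) that by (metis imageI inv_closed)
    then show ?thesis using that by (simp add: conj_by_def)
  qed
  then show "A \<lhd> G" using A(1) by (simp add: normal_inv_iff)
qed

lemma normal_conj_by_mem: "\<lbrakk>A \<lhd> G; g \<in> carrier G; a \<in> A\<rbrakk> \<Longrightarrow> conj_by g a \<in> A"
  using normal_iff_conj_by by blast

lemma mem_set_mult: "x \<in> A <#> B \<longleftrightarrow> (\<exists>a\<in>A. \<exists>b\<in>B. x = a \<otimes> b)"
  by (auto simp: set_mult_def)

lemma set_multE:
  assumes "x \<in> A <#> B"
  obtains a b where "a \<in> A" "b \<in> B" "x = a \<otimes> b"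
  using assms mem_set_mult by blast

lemma normal_subset: "A \<lhd> G \<Longrightarrow> A \<subseteq> carrier G"
  using normal_imp_subgroup subgroup.subset by blast

lemma set_mult_upper:
  assumes "subgroup A G" "subgroup B G"
  shows "A \<subseteq> A <#> B" "B \<subseteq> A <#> B"
proof -
  show "A \<subseteq> A <#> B"
  proof
    fix a assume "a \<in> A"
    then have "a = a \<otimes> \<one>" using subgroup.mem_carrier[OF assms(1)] by simp
    then show "a \<in> A <#> B" using \<open>a \<in> A\<close> subgroup.one_closed[OF assms(2)] mem_set_mult by blast
  qed
  show "B \<subseteq> A <#> B"
  proof
    fix b assume "b \<in> B"
    then have "b = \<one> \<otimes> b" using subgroup.mem_carrier[OF assms(2)] by simp
    then show "b \<in> A <#> B" using \<open>b \<in> B\<close> subgroup.one_closed[OF assms(1)] mem_set_mult by blast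
  qed
qed

lemma set_mult_least:
  "\<lbrakk>subgroup C G; A \<subseteq> C; B \<subseteq> C\<rbrakk> \<Longrightarrow> A <#> B \<subseteq> C"
  using subgroup.m_closed[of C G] by (auto simp: mem_set_mult subset_eq)

text \<open>A normal p-subgroup is conjugate into any Sylow subgroup and equals its conjugates, so
  it lies in every Sylow subgroup. The product of two such subgroups therefore lies in one Sylow
  subgroup and is a p-group again.\<close>

lemma p_core_props:
  assumes p: "Factorial_Ring.prime p"
  shows "p_core p G \<lhd> G" and "p_subgroup p (p_core p G)"
    and "\<lbrakk>A \<lhd> G; p_subgroup p A\<rbrakk> \<Longrightarrow> A \<subseteq> p_core p G"
    and "sylow_in p (carrier G) T \<Longrightarrow> p_core p G \<subseteq> T"
proof -
  define Q where "Q = (\<lambda>A. A \<lhd> G \<and> (\<exists>n. card A = p ^ n))"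
  have Q_iff: "Q A \<longleftrightarrow> A \<lhd> G \<and> p_subgroup p A" for A
    by (auto simp: Q_def p_subgroup_def normal_imp_subgroup)
  have core: "p_core p G = Greatest Q"
    unfolding p_core_def Q_def ..
  have in_sylow: "A \<subseteq> T" if A: "Q A" and T: "sylow_in p (carrier G) T" for A T
  proof -
    have A': "A \<lhd> G" "p_subgroup p A" using A Q_iff by auto
    then obtain g where "g \<in> carrier G" "conj_by g ` A \<subseteq> T"
      using T normal_subset[OF A'(1)] unfolding sylow_in_def by blast
    then show ?thesis using A'(1) normal_iff_conj_by by auto
  qed
  have carrier: "subgroup (carrier G) G" by (rule subgroup_self)
  obtain T0 where T0: "sylow_in p (carrier G) T0"
    using sylow_in_exists[OF p carrier] by blast
  have dir: "\<exists>C. Q C \<and> A \<subseteq> C \<and> B \<subseteq> C" if "Q A" "Q B" for A B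
  proof (intro exI conjI)
    have AB: "A \<lhd> G" "B \<lhd> G" using that Q_iff by auto
    then have nrm: "A <#> B \<lhd> G" by (rule normal_subgroup_set_mult_closed)
    have sT: "subgroup T0 G" "p_subgroup p T0" using T0 by (auto simp: sylow_in_def p_subgroup_def)
    then have "A <#> B \<subseteq> T0"
      using in_sylow T0 that by (intro set_mult_least) auto
    then have "p_subgroup p (A <#> B)"
      using p_subgroup_subset[OF p sT(2) normal_imp_subgroup[OF nrm]] by blast
    then show "Q (A <#> B)" using nrm Q_iff by blast
    show "A \<subseteq> A <#> B" "B \<subseteq> A <#> B"
      using set_mult_upper[OF AB[THEN normal_imp_subgroup]] .
  qed
  have sub: "A \<subseteq> carrier G" if "Q A" for A using that Q_iff normal_subset by blast
  have one: "Q {\<one>}" unfolding Q_def using one_is_normal by (auto intro: exI[of _ 0])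
  note G = Greatest_directed[of "carrier G" Q, OF finite_carrier sub one dir]
  show "p_core p G \<lhd> G" "p_subgroup p (p_core p G)"
    using G(1) Q_iff core by auto
  show "\<lbrakk>A \<lhd> G; p_subgroup p A\<rbrakk> \<Longrightarrow> A \<subseteq> p_core p G"
    using G(2) Q_iff core by auto
  show "sylow_in p (carrier G) T \<Longrightarrow> p_core p G \<subseteq> T"
    using G(1) in_sylow core by auto
qed

(* Cyclicity of H/K in terms of representatives, so that chief factors can be compared without
   isomorphisms of quotient groups. *)
definition cyclic_over :: "'a set \<Rightarrow> 'a set \<Rightarrow> bool"
  where "cyclic_over H K \<longleftrightarrow> (\<exists>y\<in>H. \<forall>h\<in>H. \<exists>n::int. h \<otimes> inv (y [^] n) \<in> K)"

section \<open>Cyclic chief factors and isomorphisms between them\<close>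

lemma r_coset_eq_iff:
  assumes "subgroup K G" "a \<in> carrier G" "b \<in> carrier G"
  shows "K #> a = K #> b \<longleftrightarrow> a \<otimes> inv b \<in> K"
proof
  assume "K #> a = K #> b"
  then have "a \<in> K #> b" using rcos_self assms by blast
  then obtain k where "k \<in> K" "a = k \<otimes> b" by (auto simp: r_coset_def)
  then show "a \<otimes> inv b \<in> K"
    using assms subgroup.mem_carrier[OF assms(1)] by (simp add: m_assoc)
next
  assume k: "a \<otimes> inv b \<in> K"
  have "a = (a \<otimes> inv b) \<otimes> b" using assms by (simp add: m_assoc)
  then have "a \<in> K #> b" using k by (auto simp: r_coset_def)
  then show "K #> a = K #> b" using repr_independence assms by blast
qed

lemma cyclic_group_iff_cyclic_over:
  assumes H: "subgroup H G" and K: "K \<lhd> G" and KH: "K \<subseteq> H"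
  shows "cyclic_group (subgrp G H Mod K) \<longleftrightarrow> cyclic_over H K"
proof -
  interpret H: finite_group "subgrp G H" using H by (rule finite_group_subgrp)
  interpret K: normal K "subgrp G H" using normal_restrict_supergroup H K KH by blast
  interpret Q: group "subgrp G H Mod K" by (rule K.factorgroup_is_group)
  have carr: "carrier (subgrp G H Mod K) = (\<lambda>h. K #> h) ` H"
    unfolding carrier_FactGroup by (auto simp: r_coset_def)
  have pow: "(K #> y) [^]\<^bsub>subgrp G H Mod K\<^esub> (n::int) = K #> (y [^] n)" if "y \<in> H" for y n
    using K.FactGroup_int_pow[of y n] that int_pow_consistent[OF H that]
    by (simp add: r_coset_def)
  have mem: "y [^] (n::int) \<in> H" if "y \<in> H" for y n
    using that int_pow_consistent[OF H that] H.int_pow_closed[of y n] by simp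
  have "cyclic_group (subgrp G H Mod K) \<longleftrightarrow>
      (\<exists>y\<in>H. (\<lambda>h. K #> h) ` H = range (\<lambda>n::int. (K #> y) [^]\<^bsub>subgrp G H Mod K\<^esub> n))"
    unfolding Q.cyclic_group carr by auto
  also have "\<dots> \<longleftrightarrow> (\<exists>y\<in>H. (\<lambda>h. K #> h) ` H = range (\<lambda>n::int. K #> (y [^] n)))"
    by (simp add: pow)
  also have "\<dots> \<longleftrightarrow> (\<exists>y\<in>H. \<forall>h\<in>H. \<exists>n::int. K #> h = K #> (y [^] n))"
  proof (intro bex_cong refl)
    fix y assume y: "y \<in> H"
    have "range (\<lambda>n::int. K #> (y [^] n)) \<subseteq> (\<lambda>h. K #> h) ` H"
      using mem[OF y] by blast
    then show "(\<lambda>h. K #> h) ` H = range (\<lambda>n::int. K #> (y [^] n)) \<longleftrightarrow>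
        (\<forall>h\<in>H. \<exists>n::int. K #> h = K #> (y [^] n))"
      by (auto simp: image_subset_iff set_eq_iff image_iff) 
  qed
  also have "\<dots> \<longleftrightarrow> cyclic_over H K"
    unfolding cyclic_over_def
    by (intro bex_cong ball_cong ex_cong1 refl r_coset_eq_iff normal_imp_subgroup[OF K])
      (use mem subgroup.mem_carrier[OF H] in auto)
  finally show ?thesis .
qed

text \<open>By the second isomorphism theorem, H = K(H \<inter> N) makes H/K isomorphic to (H
  \<inter> N)/(K \<inter> N), compatibly with conjugation. A normal L between the two intersections
  corresponds to KL between K and H, and a generator modulo K \<inter> N is also one modulo
  K.\<close>

lemma chief_factor_Int:
  assumes c: "chief_factor G H K" and N: "N \<lhd> G" and H: "H \<subseteq> K <#> (H \<inter> N)"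
  shows "chief_factor G (H \<inter> N) (K \<inter> N)"
    and "cyclic_over (H \<inter> N) (K \<inter> N) \<Longrightarrow> cyclic_over H K"
proof -
  have nrm: "H \<lhd> G" "K \<lhd> G" and KH: "K \<subset> H"
    and minimal: "\<And>L. \<lbrakk>L \<lhd> G; K \<subseteq> L; L \<subseteq> H\<rbrakk> \<Longrightarrow> L = K \<or> L = H"
    using c unfolding chief_factor_def by blast+
  note sub = nrm[THEN normal_imp_subgroup] N[THEN normal_imp_subgroup]
  have nrm': "H \<inter> N \<lhd> G" "K \<inter> N \<lhd> G"
    using nrm N normal_subgroup_intersect by auto
  show "chief_factor G (H \<inter> N) (K \<inter> N)"
    unfolding chief_factor_def
  proof (intro conjI nrm' notI)
    have "\<not> H \<inter> N \<subseteq> K"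
      using H set_mult_least[OF sub(2), of K "H \<inter> N"] KH by blast
    then show "K \<inter> N \<subset> H \<inter> N" using KH by blast
    assume "\<exists>L. L \<lhd> G \<and> K \<inter> N \<subset> L \<and> L \<subset> H \<inter> N"
    then obtain L where L: "L \<lhd> G" "K \<inter> N \<subset> L" "L \<subset> H \<inter> N" by blast
    note sL = normal_imp_subgroup[OF L(1)]
    have "K <#> L \<lhd> G" using normal_subgroup_set_mult_closed nrm(2) L(1) .
    moreover have "K \<subseteq> K <#> L" "L \<subseteq> K <#> L" using set_mult_upper[OF sub(2) sL] .
    moreover have "K <#> L \<subseteq> H" using set_mult_least[OF sub(1), of K L] KH L(3) by blast
    ultimately have "K <#> L = K \<or> K <#> L = H" using minimal by blast
    then show False
    proof
      assume "K <#> L = K"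
      then have "L \<subseteq> K" using \<open>L \<subseteq> K <#> L\<close> by simp
      then show False using L by blast
    next
      assume eq: "K <#> L = H"
      \<comment> \<open>Dedekind's argument: if x = k l lies in N, then so does k = x l^-1, hence k
        \<in> K \<inter> N \<le> L.\<close>
      have "H \<inter> N \<subseteq> L"
      proof
        fix x assume x: "x \<in> H \<inter> N"
        then obtain k l where kl: "k \<in> K" "l \<in> L" "x = k \<otimes> l"
          using eq set_multE[of x K L] by blast
        have carr: "k \<in> carrier G" "l \<in> carrier G"
          using kl subgroup.mem_carrier sub(2) sL by metis+
        have "k = x \<otimes> inv l" using kl carr by (simp add: m_assoc)
        moreover have "l \<in> N" using kl L(3) by blast
        ultimately have "k \<in> N"
          using x sub(3) by (simp add: subgroup.m_closed subgroup.m_inv_closed)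
        then have "k \<in> L" using kl L(2) by blast
        then show "x \<in> L" using kl sL subgroup.m_closed by metis
      qed
      then show False using L(3) by blast
    qed
  qed
  assume "cyclic_over (H \<inter> N) (K \<inter> N)"
  then obtain y where y: "y \<in> H \<inter> N" "\<And>h. h \<in> H \<inter> N \<Longrightarrow> \<exists>n::int. h \<otimes> inv (y [^] n) \<in> K \<inter> N"
    unfolding cyclic_over_def by blast
  have yG: "y \<in> carrier G" using y(1) subgroup.mem_carrier[OF sub(1)] by blast
  have "\<exists>n::int. h \<otimes> inv (y [^] n) \<in> K" if h: "h \<in> H" for h
  proof -
    obtain k a where ka: "k \<in> K" "a \<in> H \<inter> N" "h = k \<otimes> a"
      using set_multE[OF subsetD[OF H h]] .
    then obtain n :: int where n: "a \<otimes> inv (y [^] n) \<in> K" using y(2) by blast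
    have "h \<otimes> inv (y [^] n) = k \<otimes> (a \<otimes> inv (y [^] n))"
      using ka yG subgroup.mem_carrier[OF sub(1)] subgroup.mem_carrier[OF sub(2)]
      by (simp add: m_assoc)
    then show ?thesis using n ka(1) subgroup.m_closed[OF sub(2)] by metis
  qed
  then show "cyclic_over H K" unfolding cyclic_over_def using y(1) by blast
qed

text \<open>If H \<inter> M \<le> K, then H \<inter> MK = K, so H/K is isomorphic to MH/MK. A normal
  L between MK and MH corresponds to H \<inter> L between K and H.\<close>

lemma chief_factor_set_mult:
  assumes c: "chief_factor G H K" and M: "M \<lhd> G" and HM: "H \<inter> M \<subseteq> K"
  shows "chief_factor G (M <#> H) (M <#> K)"
    and "cyclic_over (M <#> H) (M <#> K) \<Longrightarrow> cyclic_over H K"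
proof -
  have nrm: "H \<lhd> G" "K \<lhd> G" and KH: "K \<subset> H"
    and minimal: "\<And>L. \<lbrakk>L \<lhd> G; K \<subseteq> L; L \<subseteq> H\<rbrakk> \<Longrightarrow> L = K \<or> L = H"
    using c unfolding chief_factor_def by blast+
  note sub = nrm[THEN normal_imp_subgroup] M[THEN normal_imp_subgroup]
  have nrm': "M <#> H \<lhd> G" "M <#> K \<lhd> G"
    using normal_subgroup_set_mult_closed[OF M] nrm by blast+
  note sub' = nrm'[THEN normal_imp_subgroup]
  note up = set_mult_upper[OF sub(3) sub(1)] set_mult_upper[OF sub(3) sub(2)]
  have dedekind: "x \<in> K" if xH: "x \<in> H" and x: "x \<in> M <#> K" for x
  proof -
    obtain m k where mk: "m \<in> M" "k \<in> K" "x = m \<otimes> k" using set_multE[OF x] .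
    have carr: "m \<in> carrier G" "k \<in> carrier G"
      using mk subgroup.mem_carrier sub by metis+
    have "m = x \<otimes> inv k" using mk carr by (simp add: m_assoc)
    moreover have "inv k \<in> H" using mk KH subgroup.m_inv_closed[OF sub(1)] by blast
    ultimately have "m \<in> H" using xH subgroup.m_closed[OF sub(1)] by blast
    then have "m \<in> K" using mk HM by blast
    then show ?thesis using mk subgroup.m_closed[OF sub(2)] by blast
  qed
  show "chief_factor G (M <#> H) (M <#> K)"
    unfolding chief_factor_def
  proof (intro conjI nrm' notI)
    have "M <#> K \<subseteq> M <#> H" using KH unfolding set_mult_def by blast
    moreover have "\<not> H \<subseteq> M <#> K" using dedekind KH by blast
    ultimately show "M <#> K \<subset> M <#> H" using up by blast
    assume "\<exists>L. L \<lhd> G \<and> M <#> K \<subset> L \<and> L \<subset> M <#> H"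
    then obtain L where L: "L \<lhd> G" "M <#> K \<subset> L" "L \<subset> M <#> H" by blast
    note sL = normal_imp_subgroup[OF L(1)]
    have "H \<inter> L \<lhd> G" using normal_subgroup_intersect nrm(1) L(1) by blast
    then have "H \<inter> L = K \<or> H \<inter> L = H" using minimal KH L(2) up by blast
    then show False
    proof
      assume eq: "H \<inter> L = K"
      have "L \<subseteq> M <#> K"
      proof
        fix x assume x: "x \<in> L"
        obtain m h where mh: "m \<in> M" "h \<in> H" "x = m \<otimes> h" 
          using set_multE[OF subsetD[OF psubset_imp_subset[OF L(3)] x]] .
        have carr: "m \<in> carrier G" "h \<in> carrier G"
          using mh subgroup.mem_carrier sub by metis+
        have "h = inv m \<otimes> x" using mh carr by (simp flip: m_assoc)
        moreover have "inv m \<in> L" using mh L(2) up subgroup.m_inv_closed[OF sL] by blast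
        ultimately have "h \<in> L" using x subgroup.m_closed[OF sL] by blast
        then show "x \<in> M <#> K" using mh eq mem_set_mult by blast
      qed
      then show False using L(2) by blast
    next
      assume "H \<inter> L = H"
      then have "M <#> H \<subseteq> L" using L(2) up by (intro set_mult_least sL) auto
      then show False using L(3) by blast
    qed
  qed
  assume "cyclic_over (M <#> H) (M <#> K)"
  then obtain y where y: "y \<in> M <#> H"
      "\<And>h. h \<in> M <#> H \<Longrightarrow> \<exists>n::int. h \<otimes> inv (y [^] n) \<in> M <#> K"
    unfolding cyclic_over_def by blast
  \<comment> \<open>A generator \<open>y\<close> of MH/MK is replaced by its
    \<open>H\<close>-component \<open>a\<close>. The two agree modulo M, hence so do their
    powers.\<close>
  obtain m a where ma: "m \<in> M" "a \<in> H" "y = m \<otimes> a"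
    using set_multE[OF y(1)] .
  have carr: "m \<in> carrier G" "a \<in> carrier G" "y \<in> carrier G"
    using ma subgroup.mem_carrier[OF sub(3)] subgroup.mem_carrier[OF sub(1)] by auto
  interpret M: normal M G by fact
  have "M #> y = M #> a"
    using r_coset_eq_iff[OF sub(3)] carr ma by (simp add: m_assoc)
  have "\<exists>n::int. h \<otimes> inv (a [^] n) \<in> K" if h: "h \<in> H" for h
  proof -
    have hG: "h \<in> carrier G" using h subgroup.mem_carrier sub by metis
    obtain n :: int where n: "h \<otimes> inv (y [^] n) \<in> M <#> K" using y(2) h up by blast
    have "M #> (y [^] n) = M #> (a [^] n)"
      using M.FactGroup_int_pow[of y n] M.FactGroup_int_pow[of a n] carr \<open>M #> y = M #> a\<close> by simp
    then have "y [^] n \<otimes> inv (a [^] n) \<in> M" using r_coset_eq_iff[OF sub(3)] carr by simp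
    then have "(h \<otimes> inv (y [^] n)) \<otimes> (y [^] n \<otimes> inv (a [^] n)) \<in> M <#> K"
      using n up subgroup.m_closed[OF sub'(2)] by blast
    moreover have "(h \<otimes> inv (y [^] n)) \<otimes> (y [^] n \<otimes> inv (a [^] n)) = h \<otimes> inv (a [^] n)"
      using hG carr by (simp add: m_assoc flip: m_assoc[of "inv (y [^] n)" "y [^] n"])
    moreover have "h \<otimes> inv (a [^] n) \<in> H"
    proof -
      have "a [^] n \<in> H"
        using int_pow_consistent[OF sub(1) ma(2)]
          group.int_pow_closed[OF subgroup_imp_group[OF sub(1)], of a n] ma(2) by simp
      then show ?thesis using h sub(1) by (simp add: subgroup.m_closed subgroup.m_inv_closed)
    qed
    ultimately show ?thesis using dedekind by metis
  qed
  then show "cyclic_over H K" unfolding cyclic_over_def using ma by blast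
qed

text \<open>The point is that the defining property holds for the \<open>GREATEST\<close> subgroup
  itself, for which it has to pass from M and N to MN. Let H/K be a chief factor below MN. By
  minimality K(H \<inter> M) is H or K. If it is H, then H/K is isomorphic to a chief factor below
  M. If it is K, then H/K is isomorphic to MH/MK, and this to a chief factor below N.\<close>

lemma hypercenter_chief_factor_cyclic:
  assumes c: "chief_factor G H K" and H: "H \<subseteq> supersolvable_hypercenter G"
  shows "cyclic_over H K"
proof -
  have cyc: "cyclic_group (subgrp G H Mod K) \<longleftrightarrow> cyclic_over H K" if "chief_factor G H K" for H K
    using that cyclic_group_iff_cyclic_over normal_imp_subgroup
    by (auto simp: chief_factor_def)
  define Q where "Q = (\<lambda>N. N \<lhd> G \<and>
    (\<forall>H K. chief_factor G H K \<and> H \<subseteq> N \<longrightarrow> cyclic_group (subgrp G H Mod K)))"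
  have Q_iff: "Q N \<longleftrightarrow> N \<lhd> G \<and> (\<forall>H K. chief_factor G H K \<and> H \<subseteq> N \<longrightarrow> cyclic_over H K)" for N
    unfolding Q_def using cyc by blast
  have hyper: "supersolvable_hypercenter G = Greatest Q"
    unfolding supersolvable_hypercenter_def Q_def ..
  have dir: "\<exists>C. Q C \<and> M \<subseteq> C \<and> N \<subseteq> C" if "Q M" "Q N" for M N
  proof (intro exI conjI)
    have MN: "M \<lhd> G" "N \<lhd> G" using that Q_iff by auto
    note sub = MN[THEN normal_imp_subgroup]
    have nrm: "M <#> N \<lhd> G" using MN by (rule normal_subgroup_set_mult_closed)
    show up: "M \<subseteq> M <#> N" "N \<subseteq> M <#> N" using set_mult_upper[OF sub] .
    have "cyclic_over H K" if c: "chief_factor G H K" and HMN: "H \<subseteq> M <#> N" for H K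
    proof -
      have nH: "H \<lhd> G" "K \<lhd> G" and KH: "K \<subset> H"
        and minimal: "\<And>L. \<lbrakk>L \<lhd> G; K \<subseteq> L; L \<subseteq> H\<rbrakk> \<Longrightarrow> L = K \<or> L = H"
        using c unfolding chief_factor_def by blast+
      note sH = nH[THEN normal_imp_subgroup]
      have nHM: "H \<inter> M \<lhd> G" using nH MN normal_subgroup_intersect by blast
      have "K <#> (H \<inter> M) = K \<or> K <#> (H \<inter> M) = H"
      proof (rule minimal)
        show "K <#> (H \<inter> M) \<lhd> G" using nH(2) nHM by (rule normal_subgroup_set_mult_closed)
        show "K \<subseteq> K <#> (H \<inter> M)" using set_mult_upper[OF sH(2) normal_imp_subgroup[OF nHM]] by blast
        show "K <#> (H \<inter> M) \<subseteq> H" using KH by (intro set_mult_least sH) auto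
      qed
      then show ?thesis
      proof
        assume "K <#> (H \<inter> M) = H"
        then show ?thesis
          using chief_factor_Int[OF c MN(1)] \<open>Q M\<close> Q_iff by blast
      next
        assume "K <#> (H \<inter> M) = K"
        then have HM: "H \<inter> M \<subseteq> K"
          using set_mult_upper[OF sH(2) normal_imp_subgroup[OF nHM]] by blast
        note c' = chief_factor_set_mult[OF c MN(1) HM]
        define H' where "H' = M <#> H"
        define K' where "K' = M <#> K"
        have c'': "chief_factor G H' K'" using c'(1) unfolding H'_def K'_def .
        have sH': "subgroup H' G" "subgroup K' G"
          using c'' normal_imp_subgroup unfolding chief_factor_def by auto
        have MK': "M \<subseteq> K'" unfolding K'_def using set_mult_upper[OF sub(1) sH(2)] by blast
        have KH': "K' \<subseteq> H'" using c'' unfolding chief_factor_def by blast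
        \<comment> \<open>From H' \<le> MN and M \<le> K', an element h = m n of H' has m in K' and
          n = m^-1 h in H' \<inter> N.\<close>
        have "H' \<subseteq> K' <#> (H' \<inter> N)"
        proof
          fix h assume h: "h \<in> H'"
          have "H' \<subseteq> M <#> N"
            unfolding H'_def using up HMN by (intro set_mult_least normal_imp_subgroup nrm)
          then obtain m n where mn: "m \<in> M" "n \<in> N" "h = m \<otimes> n"
            using set_multE[of h M N] h by blast
          have "m \<in> carrier G" "n \<in> carrier G" using mn subgroup.mem_carrier sub by metis+
          then have "n = inv m \<otimes> h" using mn by (simp flip: m_assoc)
          moreover have "inv m \<in> H'" using mn MK' KH' subgroup.m_inv_closed[OF sH'(1)] by blast
          ultimately have "n \<in> H'" using h subgroup.m_closed[OF sH'(1)] by blast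
          then show "h \<in> K' <#> (H' \<inter> N)" using mn MK' mem_set_mult by blast
        qed
        then have "cyclic_over H' K'"
          using chief_factor_Int[OF c'' MN(2)] \<open>Q N\<close> Q_iff by blast
        then show ?thesis using c'(2) unfolding H'_def K'_def by blast
      qed
    qed
    then show "Q (M <#> N)" using nrm Q_iff by blast
  qed
  have sub: "N \<subseteq> carrier G" if "Q N" for N using that Q_iff normal_subset by blast
  have one: "Q {\<one>}"
    unfolding Q_iff
  proof (intro conjI allI impI one_is_normal)
    fix H K assume HK: "chief_factor G H K \<and> H \<subseteq> {\<one>}"
    then have "K \<subset> {\<one>}" "subgroup K G"
      unfolding chief_factor_def using normal_imp_subgroup by blast+
    then show "cyclic_over H K" using subgroup.one_closed by blast
  qed
  have "Q (supersolvable_hypercenter G)"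
    unfolding hyper using Greatest_directed(1)[of "carrier G" Q, OF finite_carrier sub one dir] .
  then show ?thesis using c H Q_iff by blast
qed

end

section \<open>Action on cyclic chief factors\<close>

lemma cong_pow_prime_power:
  assumes "Factorial_Ring.prime (p::nat)"
  shows "[a ^ p ^ k = a] (mod p)"
proof (induction k)
  case (Suc k)
  have fermat: "[b ^ p = b] (mod p)" for b
  proof (cases "p dvd b")
    case True
    then have "p dvd b ^ p" using assms prime_gt_0_nat dvd_power_same[of p b p] dvd_trans
      by (metis dvd_power)
    then show ?thesis using True by (simp add: cong_def mod_eq_0_iff_dvd)
  next
    case False
    then have "[b ^ (p - 1) * b = 1 * b] (mod p)"
      using fermat_theorem assms by (intro cong_mult) auto
    moreover have "b ^ (p - 1) * b = b ^ p"
      using assms prime_gt_0_nat by (metis power_minus_mult)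
    ultimately show ?thesis by simp
  qed
  have "a ^ p ^ Suc k = (a ^ p ^ k) ^ p" by (metis power_Suc2 power_mult)
  then show ?case using fermat[of "a ^ p ^ k"] Suc cong_trans by metis
qed simp

context finite_group
begin

(* If u acts as the a-th power map, then u^(p^k) = 1 acts as the a^(p^k)-th power map, and
   a^(p^k) = a mod p. *)
lemma conj_by_cyclic_prime:
  assumes p: "Factorial_Ring.prime (p::nat)" and u: "u \<in> carrier G" "u [^] (p ^ k) = \<one>"
    and v: "v \<in> carrier G" "v [^] p = \<one>" and uv: "conj_by u v = v [^] (n::int)"
  shows "conj_by u v = v"
proof -
  define a where "a = nat (n mod int p)"
  have "v [^] n = v [^] (n mod int p)"
  proof -
    have "v [^] n = v [^] (int p * (n div int p)) \<otimes> v [^] (n mod int p)"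
      using v by (simp flip: int_pow_mult)
    then show ?thesis using v by (simp add: int_pow_int flip: int_pow_pow)
  qed
  also have "\<dots> = v [^] a"
    using prime_gt_0_nat[OF p] by (simp add: a_def flip: int_pow_int)
  finally have uv': "conj_by u v = v [^] a" using uv by simp
  have "conj_by (u [^] j) v = v [^] (a ^ j)" for j :: nat
  proof (induction j)
    case (Suc j)
    have "conj_by (u [^] Suc j) v = conj_by u (conj_by (u [^] j) v)"
      using u v by (simp add: conj_by_conj_by)
    also have "\<dots> = (conj_by u v) [^] (a ^ j)" using Suc u v by (simp add: conj_by_pow)
    also have "\<dots> = v [^] (a ^ Suc j)" using uv' v by (simp add: nat_pow_pow)
    finally show ?case .
  qed (use v in simp)
  from this[of "p ^ k"] have "v = v [^] (a ^ p ^ k)" using u v by simp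
  also have "\<dots> = v [^] a"
  proof -
    have red: "v [^] b = v [^] (b mod p)" for b :: nat
    proof -
      have "v [^] b = v [^] (p * (b div p)) \<otimes> v [^] (b mod p)"
        using v by (simp add: nat_pow_mult)
      then show ?thesis using v by (simp flip: nat_pow_pow)
    qed
    show ?thesis
      using cong_pow_prime_power[OF p, of a k] red[of a] red[of "a ^ p ^ k"] by (simp add: cong_def)
  qed
  finally show ?thesis using uv' by simp
qed

lemma p_subgroup_pow:
  assumes "p_subgroup p Q" "x \<in> Q"
  shows "\<exists>n. x [^] (p ^ n) = \<one>"
proof -
  obtain n where n: "subgroup Q G" "card Q = p ^ n" using assms(1) by (auto simp: p_subgroup_def)
  interpret Q: finite_group "subgrp G Q" using n(1) by (rule finite_group_subgrp)
  have "x [^]\<^bsub>subgrp G Q\<^esub> order (subgrp G Q) = \<one>"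
    using Q.pow_order_eq_1[of x] assms(2) by simp
  then show ?thesis
    using n by (auto simp: order_def simp flip: nat_pow_consistent)
qed

text \<open>H/K is cyclic, hence abelian, so the elements of H with p-th power in K form a subgroup
  L, normal in \<open>G\<close>. It is larger than K because the nontrivial p-group H/K has elements
  of order p; minimality of H/K gives L = H.\<close>

lemma chief_factor_pow_prime:
  assumes p: "Factorial_Ring.prime p" and c: "chief_factor G H K"
    and H: "p_subgroup p H" and cyc: "cyclic_over H K" and h: "h \<in> H"
  shows "h [^] p \<in> K"
proof -
  have nrm: "H \<lhd> G" "K \<lhd> G" and KH: "K \<subset> H"
    and minimal: "\<And>L. \<lbrakk>L \<lhd> G; K \<subseteq> L; L \<subseteq> H\<rbrakk> \<Longrightarrow> L = K \<or> L = H"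
    using c unfolding chief_factor_def by blast+
  note sub = nrm[THEN normal_imp_subgroup]
  have HG: "x \<in> carrier G" if "x \<in> H" for x using that subgroup.mem_carrier[OF sub(1)] by blast
  interpret H: finite_group "subgrp G H" using sub(1) by (rule finite_group_subgrp)
  interpret K: normal K "subgrp G H" using normal_restrict_supergroup sub(1) nrm(2) KH by blast
  interpret Q: group "subgrp G H Mod K" by (rule K.factorgroup_is_group)
  have "cyclic_group (subgrp G H Mod K)"
    using cyclic_group_iff_cyclic_over sub(1) nrm(2) KH cyc by blast
  then interpret Q: comm_group "subgrp G H Mod K" by (rule Q.cyclic_imp_abelian_group)
  have carr: "K #> x \<in> carrier (subgrp G H Mod K)" if "x \<in> H" for x
    using that unfolding carrier_FactGroup by (auto simp: r_coset_def)
  have mult: "K #> (x \<otimes> y) = (K #> x) \<otimes>\<^bsub>subgrp G H Mod K\<^esub> (K #> y)" if "x \<in> H" "y \<in> H" for x y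
    using K.rcos_sum[of x y] that by (simp add: r_coset_def set_mult_def)
  have pow: "(K #> x) [^]\<^bsub>subgrp G H Mod K\<^esub> (n::nat) = K #> (x [^] n)" if "x \<in> H" for x n
    using K.FactGroup_pow[of x n] that nat_pow_consistent[of x n H] by (simp add: r_coset_def)
  have mem_pow: "x [^] (n::nat) \<in> H" if "x \<in> H" for x n
    using that nat_pow_consistent[of x n H] H.nat_pow_closed[of x n] by simp
  have coset_K: "K #> x = K \<longleftrightarrow> x \<in> K" if "x \<in> H" for x
    using r_coset_eq_iff[OF sub(2), of x \<one>] HG[OF that] coset_mult_one[OF subgroup.subset[OF sub(2)]]
    by simp
  define L where "L = {x \<in> H. x [^] p \<in> K}"
  have L_iff: "x \<in> L \<longleftrightarrow> x \<in> H \<and> (K #> x) [^]\<^bsub>subgrp G H Mod K\<^esub> p = \<one>\<^bsub>subgrp G H Mod K\<^esub>" for x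
    unfolding L_def using coset_K[OF mem_pow] by (simp add: pow cong: conj_cong)
  have sL: "subgroup L G"
  proof (rule subgroupI)
    show "L \<subseteq> carrier G" using HG by (auto simp: L_def)
    show "L \<noteq> {}" using sub subgroup.one_closed by (auto simp: L_def intro!: exI[of _ \<one>])
    fix x assume x: "x \<in> L"
    then have "inv x \<in> H" "inv x [^] p = inv (x [^] p)"
      using sub(1) HG by (auto simp: L_def subgroup.m_inv_closed nat_pow_inv)
    then show "inv x \<in> L" using x sub(2) by (auto simp: L_def subgroup.m_inv_closed)
    fix y assume y: "y \<in> L"
    show "x \<otimes> y \<in> L"
      using x y sub(1) by (simp add: L_iff mult carr Q.nat_pow_distrib subgroup.m_closed
          del: mult_FactGroup one_FactGroup)
  qed
  have "L \<lhd> G"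
    unfolding normal_iff_conj_by
  proof (intro conjI sL ballI)
    fix g assume g: "g \<in> carrier G"
    show "conj_by g ` L = L"
    proof (rule conj_by_subset_eq[OF g subgroup.subset[OF sL]])
      show "conj_by g ` L \<subseteq> L"
        using g normal_conj_by_mem[OF nrm(1) g] normal_conj_by_mem[OF nrm(2) g] HG
        by (auto simp: L_def simp flip: conj_by_pow)
    qed
  qed
  moreover have "K \<subseteq> L"
  proof
    fix x assume x: "x \<in> K"
    have "x [^] p \<in> K"
      using x nat_pow_consistent[of x p K]
        monoid.nat_pow_closed[OF group.is_monoid[OF subgroup_imp_group[OF sub(2)]], of x p] by simp
    then show "x \<in> L" using x KH by (auto simp: L_def)
  qed
  moreover have "L \<noteq> K"
  proof -
    obtain y where y: "y \<in> H" "y \<notin> K" using KH by blast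
    obtain n where n: "y [^] (p ^ n) = \<one>" using p_subgroup_pow H y(1) by blast
    \<comment> \<open>The exponent \<open>m\<close> is positive because \<open>y\<close> is outside
      K. With m = k + 1, the power of \<open>y\<close> with exponent p^k lies in L but not in
      K.\<close>
    define m where "m = (LEAST m. y [^] (p ^ m) \<in> K)"
    have m: "y [^] (p ^ m) \<in> K"
      unfolding m_def by (rule LeastI[of _ n]) (use n sub subgroup.one_closed in simp)
    have "m \<noteq> 0" using m y HG by (metis nat_pow_eone power_0)
    then obtain k where k: "m = Suc k" by (cases m) auto
    have "y [^] (p ^ k) \<notin> K"
      using not_less_Least[of k "\<lambda>m. y [^] (p ^ m) \<in> K"] k m_def by simp
    moreover have "(y [^] (p ^ k)) [^] p \<in> K"
      using m k HG[OF y(1)] by (simp add: nat_pow_pow mult.commute)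
    ultimately show ?thesis using mem_pow[OF y(1)] by (auto simp: L_def)
  qed
  ultimately have "L = H" using minimal[of L] by (auto simp: L_def)
  then show ?thesis using h by (auto simp: L_def)
qed

text \<open>The intersection of the centralizers of all chief factors H/K of \<open>G\<close> below
  \<open>P\<close>. Taking all of them avoids the choice of a series.\<close>

definition stability_group :: "'a set \<Rightarrow> 'a set"
  where "stability_group P = {t \<in> carrier G.
    \<forall>H K. chief_factor G H K \<and> H \<subseteq> P \<longrightarrow> (\<forall>h\<in>H. K #> conj_by t h = K #> h)}"

text \<open>In G/K the image of \<open>t\<close> acts on the cyclic group H/K of exponent p by a
  power map, so \<open>conj_by_cyclic_prime\<close> shows that it fixes a generator.\<close>

lemma p_element_stability_group:
  assumes p: "Factorial_Ring.prime p" and P: "p_subgroup p P"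
    and cyc: "\<And>H K. \<lbrakk>chief_factor G H K; H \<subseteq> P\<rbrakk> \<Longrightarrow> cyclic_over H K"
    and t: "t \<in> carrier G" "t [^] (p ^ k) = \<one>"
  shows "t \<in> stability_group P"
  unfolding stability_group_def
proof (intro CollectI conjI t allI impI ballI; elim conjE)
  fix H K h assume c: "chief_factor G H K" and HP: "H \<subseteq> P" and h: "h \<in> H"
  have nrm: "H \<lhd> G" "K \<lhd> G" using c unfolding chief_factor_def by blast+
  note sub = nrm[THEN normal_imp_subgroup]
  have HG: "x \<in> carrier G" if "x \<in> H" for x using that subgroup.mem_carrier[OF sub(1)] by blast
  interpret K: normal K G by fact
  interpret Q: finite_group "G Mod K"
    by (intro finite_group.intro finite_group_axioms.intro K.factorgroup_is_group)
      (simp add: carrier_FactGroup)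
  define \<pi> where "\<pi> = (\<lambda>x. K #> x)"
  have carr: "\<pi> x \<in> carrier (G Mod K)" if "x \<in> carrier G" for x
    using that by (simp add: carrier_FactGroup \<pi>_def)
  have \<pi>_mult: "\<pi> (x \<otimes> y) = \<pi> x \<otimes>\<^bsub>G Mod K\<^esub> \<pi> y" if "x \<in> carrier G" "y \<in> carrier G" for x y
    using that by (simp add: \<pi>_def K.rcos_sum)
  have \<pi>_pow: "\<pi> x [^]\<^bsub>G Mod K\<^esub> (n::nat) = \<pi> (x [^] n)" if "x \<in> carrier G" for x n
    using that by (simp add: \<pi>_def K.FactGroup_pow)
  have \<pi>_int_pow: "\<pi> x [^]\<^bsub>G Mod K\<^esub> (n::int) = \<pi> (x [^] n)" if "x \<in> carrier G" for x n
    using that by (simp add: \<pi>_def K.FactGroup_int_pow)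
  have \<pi>_one: "\<pi> x = \<one>\<^bsub>G Mod K\<^esub>" if "x \<in> K" for x
    using that sub(2) coset_join2 subgroup.mem_carrier[OF sub(2)] by (simp add: \<pi>_def)
  have \<pi>_inv: "\<pi> (inv x) = inv\<^bsub>G Mod K\<^esub> \<pi> x" if "x \<in> carrier G" for x
    using that \<pi>_mult[of "inv x" x] \<pi>_one[of \<one>] sub(2) carr
    by (intro Q.inv_equality[symmetric]) (auto simp: subgroup.one_closed)
  have \<pi>_conj: "\<pi> (conj_by g x) = Q.conj_by (\<pi> g) (\<pi> x)" if "x \<in> carrier G" "g \<in> carrier G" for x g
    using that by (simp add: conj_by_def Q.conj_by_def \<pi>_mult \<pi>_inv del: mult_FactGroup)
  obtain y where y: "y \<in> H" "\<And>h. h \<in> H \<Longrightarrow> \<exists>n::int. h \<otimes> inv (y [^] n) \<in> K"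
    using cyc[OF c HP] unfolding cyclic_over_def by blast
  have gen: "\<exists>n::int. \<pi> h = \<pi> y [^]\<^bsub>G Mod K\<^esub> n" if "h \<in> H" for h
    using y(2)[OF that] HG[OF that] HG[OF y(1)] r_coset_eq_iff[OF sub(2)]
    by (auto simp: \<pi>_int_pow) (auto simp: \<pi>_def)
  have tG: "t \<in> carrier G" by fact
  obtain n :: int where "\<pi> (conj_by t y) = \<pi> y [^]\<^bsub>G Mod K\<^esub> n"
    using gen normal_conj_by_mem[OF nrm(1) tG y(1)] by blast
  then have n: "Q.conj_by (\<pi> t) (\<pi> y) = \<pi> y [^]\<^bsub>G Mod K\<^esub> n"
    using \<pi>_conj[OF HG[OF y(1)] tG] by simp
  have "p_subgroup p H" using p_subgroup_subset[OF p P sub(1) HP] .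
  then have "y [^] p \<in> K" using chief_factor_pow_prime[OF p c _ cyc[OF c HP] y(1)] by blast
  then have yp: "\<pi> y [^]\<^bsub>G Mod K\<^esub> p = \<one>\<^bsub>G Mod K\<^esub>"
    using \<pi>_pow \<pi>_one HG[OF y(1)] by simp
  have tp: "\<pi> t [^]\<^bsub>G Mod K\<^esub> (p ^ k) = \<one>\<^bsub>G Mod K\<^esub>"
    using \<pi>_pow[OF tG] \<pi>_one[of \<one>] t(2) subgroup.one_closed[OF sub(2)] by simp
  have fix_y: "Q.conj_by (\<pi> t) (\<pi> y) = \<pi> y"
    using Q.conj_by_cyclic_prime[OF p carr[OF tG] tp carr[OF HG[OF y(1)]] yp n] .
  obtain m :: int where m: "\<pi> h = \<pi> y [^]\<^bsub>G Mod K\<^esub> m" using gen[OF h] by blast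
  have comm: "\<pi> y \<otimes>\<^bsub>G Mod K\<^esub> \<pi> t = \<pi> t \<otimes>\<^bsub>G Mod K\<^esub> \<pi> y"
    using fix_y Q.conj_by_eq_iff carr tG HG y(1) by blast
  have "Q.conj_by (\<pi> t) (\<pi> h) = \<pi> h"
  proof -
    \<comment> \<open>The centralizer of the image of \<open>t\<close> is a subgroup, so with the
      generator \<open>\<pi> y\<close> it contains all powers of it, in particular
      \<open>\<pi> h\<close>.\<close>
    have C: "subgroup (Q.centralizer_of {\<pi> t}) (G Mod K)"
      using Q.subgroup_centralizer_of carr tG by simp
    have C_iff: "x \<in> Q.centralizer_of {\<pi> t} \<longleftrightarrow> x \<in> carrier (G Mod K) \<and>
        \<pi> t \<otimes>\<^bsub>G Mod K\<^esub> x = x \<otimes>\<^bsub>G Mod K\<^esub> \<pi> t" for x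
      using Q.conj_by_eq_iff carr tG by (auto simp: Q.centralizer_of_def)
    have "\<pi> y \<in> Q.centralizer_of {\<pi> t}" using C_iff comm carr HG y(1) by simp
    then have "\<pi> h \<in> Q.centralizer_of {\<pi> t}"
      using m Q.int_pow_consistent[OF C]
        group.int_pow_closed[OF Q.subgroup_imp_group[OF C], of "\<pi> y" m] by simp
    then show ?thesis using C_iff Q.conj_by_eq_iff carr tG HG h by simp
  qed
  then show "K #> conj_by t h = K #> h"
    using \<pi>_conj[OF HG[OF h] tG] by (simp add: \<pi>_def)
qed

lemma stability_group_normal: "stability_group P \<lhd> G"
  unfolding normal_iff_conj_by
proof (intro conjI ballI)
  have H: "x \<in> carrier G" "conj_by g x \<in> H"
    if "chief_factor G H K" "x \<in> H" "g \<in> carrier G" for H K x g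
    using that normal_conj_by_mem[of H g x] normal_subset[of H] by (auto simp: chief_factor_def)
  have sG: "t \<in> carrier G" if "t \<in> stability_group P" for t
    using that by (simp add: stability_group_def)
  show sub: "subgroup (stability_group P) G"
  proof (rule subgroupI)
    show "stability_group P \<noteq> {}"
    proof -
      have "K #> conj_by \<one> h = K #> h" if "chief_factor G H K" "h \<in> H" for H K h
        using H(1)[OF that one_closed] by simp
      then have "\<one> \<in> stability_group P" unfolding stability_group_def by blast
      then show ?thesis by blast
    qed
    fix t assume t: "t \<in> stability_group P"
    note tG = sG[OF t]
    have "K #> conj_by (inv t) h = K #> h"
      if "chief_factor G H K" "H \<subseteq> P" "h \<in> H" for H K h
    proof -
      have "K #> conj_by t (conj_by (inv t) h) = K #> conj_by (inv t) h"
        using t that H(2)[OF that(1) that(3) inv_closed[OF tG]] unfolding stability_group_def by blast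
      then show ?thesis using tG H(1)[OF that(1) that(3) tG] by simp
    qed
    then show "inv t \<in> stability_group P" using tG by (auto simp: stability_group_def)
    fix s assume s: "s \<in> stability_group P"
    have "K #> conj_by (t \<otimes> s) h = K #> h"
      if "chief_factor G H K" "H \<subseteq> P" "h \<in> H" for H K h
    proof -
      have "K #> conj_by s (conj_by t h) = K #> conj_by t h"
        using s that H(2)[OF that(1) that(3) tG] unfolding stability_group_def by blast
      also have "\<dots> = K #> h" using t that unfolding stability_group_def by blast
      finally show ?thesis using tG sG[OF s] H(1)[OF that(1) that(3) tG] by (simp add: conj_by_conj_by)
    qed
    then show "t \<otimes> s \<in> stability_group P" using tG sG[OF s] by (auto simp: stability_group_def)
  qed (auto simp: stability_group_def)
  fix g assume g: "g \<in> carrier G"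
  show "conj_by g ` stability_group P = stability_group P"
  proof (rule conj_by_subset_eq[OF g subgroup.subset[OF sub]]; rule image_subsetI)
    fix t assume t: "t \<in> stability_group P"
    note tG = sG[OF t]
    have "K #> conj_by (conj_by g t) h = K #> h"
      if c: "chief_factor G H K" and HP: "H \<subseteq> P" and h: "h \<in> H" for H K h
    proof -
      have K: "K \<lhd> G" using c by (simp add: chief_factor_def)
      note sK = normal_imp_subgroup[OF K]
      \<comment> \<open>\<open>t\<close> moves x = h^(g^-1) only within its coset of K. Conjugating
        by \<open>g\<close>, which preserves K, shows the same for t^g and \<open>h\<close>.\<close>
      define x where "x = conj_by (inv g) h"
      have x: "x \<in> H" "x \<in> carrier G" "h = conj_by g x"
        using H[OF c h] H(2)[OF c h inv_closed[OF g]] H(1)[OF c] g by (auto simp: x_def)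
      have "K #> conj_by t x = K #> x" using t c HP x(1) unfolding stability_group_def by blast
      then have "conj_by t x \<otimes> inv x \<in> K" using r_coset_eq_iff[OF sK] tG x by simp
      then have "conj_by g (conj_by t x \<otimes> inv x) \<in> K" by (rule normal_conj_by_mem[OF K g])
      then have "conj_by g (conj_by t x) \<otimes> inv h \<in> K"
        using g tG x by (simp add: conj_by_mult conj_by_inv)
      then have "K #> conj_by g (conj_by t x) = K #> h"
        using r_coset_eq_iff[OF sK] g tG x by simp
      moreover have "conj_by g (conj_by t x) = conj_by (conj_by g t) h"
        unfolding x(3) using g tG x(2) by (simp add: conj_by_def inv_mult_group m_assoc
            flip: m_assoc[of g "inv g"])
      ultimately show ?thesis by simp
    qed
    then show "conj_by g t \<in> stability_group P"
      using g tG by (auto simp: stability_group_def)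
  qed
qed

section \<open>Elements of order prime to p and the structure of the stability group\<close>

lemma chief_factor_exists:
  assumes M: "M \<lhd> G" "M \<noteq> {\<one>}"
  shows "\<exists>K. chief_factor G M K"
proof -
  define A where "A = {K. K \<lhd> G \<and> K \<subset> M}"
  have "{\<one>} \<in> A"
    using M one_is_normal subgroup.one_closed[OF normal_imp_subgroup[OF M(1)]] by (auto simp: A_def)
  moreover have "A \<subseteq> Pow M" by (auto simp: A_def)
  then have "finite A"
    using finite_subset_carrier[OF normal_subset[OF M(1)]] finite_subset by blast
  ultimately obtain K where K: "K \<in> A" "\<And>L. L \<in> A \<Longrightarrow> K \<subseteq> L \<Longrightarrow> L = K"
    using finite_has_maximal[of A] by blast
  then have "chief_factor G M K"
    using M(1) by (auto simp: chief_factor_def A_def)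
  then show ?thesis ..
qed

text \<open>Induction along a chief series below \<open>P\<close>. Let M/K be a chief factor.
  \<open>t\<close> sends y to z y with z in K, and fixes z by induction; so t^j sends y to z^j y.
  Now t^m = 1 gives z^m = 1, while z has p-power order, so z = 1.\<close>

lemma p'_element_centralizes:
  assumes p: "Factorial_Ring.prime p" and P: "p_subgroup p P"
    and t: "t \<in> stability_group P" "t [^] (m::nat) = \<one>" "\<not> p dvd m"
    and M: "M \<lhd> G" "M \<subseteq> P" and y: "y \<in> M"
  shows "conj_by t y = y"
  using M y
proof (induction "card M" arbitrary: M y rule: less_induct)
  case less
  have tG: "t \<in> carrier G" using t(1) by (simp add: stability_group_def)
  note MG = subsetD[OF normal_subset[OF less.prems(1)]]
  show ?case
  proof (cases "M = {\<one>}")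
    case True
    then show ?thesis using less.prems tG by simp
  next
    case False
    obtain K where K: "chief_factor G M K"
      using chief_factor_exists less.prems(1) False by blast
    then have K': "K \<lhd> G" "K \<subset> M" by (auto simp: chief_factor_def)
    have yG: "y \<in> carrier G" using MG less.prems by blast
    define z where "z = conj_by t y \<otimes> inv y"
    have "K #> conj_by t y = K #> y"
      using t(1) K less.prems unfolding stability_group_def by blast
    then have zK: "z \<in> K"
      using r_coset_eq_iff[OF normal_imp_subgroup[OF K'(1)]] tG yG by (simp add: z_def)
    have zG: "z \<in> carrier G" using tG yG by (simp add: z_def)
    have "card K < card M"
      using K' finite_subset_carrier[OF normal_subset[OF less.prems(1)]] psubset_card_mono by blast
    then have tz: "conj_by t z = z"
      using less.hyps[of K z] K' zK less.prems by blast
    have ty: "conj_by t y = z \<otimes> y" using tG yG by (simp add: z_def m_assoc)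
    have "conj_by (t [^] j) y = z [^] j \<otimes> y" for j :: nat
    proof (induction j)
      case (Suc j)
      have "conj_by (t [^] Suc j) y = conj_by t (conj_by (t [^] j) y)"
        using tG yG by (simp add: conj_by_conj_by)
      also have "\<dots> = z [^] j \<otimes> (z \<otimes> y)"
        using Suc tG yG zG tz ty by (simp add: conj_by_mult conj_by_pow)
      finally show ?case using zG yG by (simp add: m_assoc)
    qed (use yG in simp)
    from this[of m] have "z [^] m = \<one>" using t(2) yG zG by simp
    moreover have "z \<in> P" using zK K' less.prems by blast
    then obtain n where "z [^] (p ^ n) = \<one>" using p_subgroup_pow[OF P] by blast
    ultimately have "ord z dvd m" "ord z dvd p ^ n" using zG pow_eq_id by blast+
    moreover have "coprime m (p ^ n)"
      using prime_imp_coprime[OF p t(3)] by (simp add: coprime_commute)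
    ultimately have "ord z = 1" by (metis coprime_common_divisor nat_dvd_1_iff_1)
    then have "z = \<one>" using zG ord_eq_1 by blast
    then show ?thesis using ty yG by simp
  qed
qed

lemma centralizer_of_conj_by:
  assumes A: "A \<subseteq> carrier G" and g: "g \<in> normalizer_of A"
  shows "conj_by g ` centralizer_of A = centralizer_of A"
proof (rule conj_by_subset_eq; (rule image_subsetI)?)
  show gG: "g \<in> carrier G" using g by (simp add: normalizer_of_def)
  show "centralizer_of A \<subseteq> carrier G" by (auto simp: centralizer_of_def)
  fix c assume c: "c \<in> centralizer_of A"
  then have cG: "c \<in> carrier G" by (simp add: centralizer_of_def)
  have "conj_by (conj_by g c) x = x" if x: "x \<in> A" for x
  proof -
    have xG: "x \<in> carrier G" using x A by blast
    have "conj_by (inv g) ` A = A"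
      using image_conj_by_inv[OF gG A] g by (simp add: normalizer_of_def)
    then have "conj_by (inv g) x \<in> A" using x by blast
    then have "conj_by c (conj_by (inv g) x) = conj_by (inv g) x"
      using c by (simp add: centralizer_of_def)
    then have "conj_by g (conj_by c (conj_by (inv g) x)) = x" using gG xG by simp
    moreover have "conj_by g (conj_by c (conj_by (inv g) x)) = conj_by (conj_by g c) x"
      using gG cG xG by (simp add: conj_by_def inv_mult_group m_assoc)
    ultimately show ?thesis by simp
  qed
  then show "conj_by g c \<in> centralizer_of A" using gG cG by (auto simp: centralizer_of_def)
qed

text \<open>Orders are compared one prime at a time. For every prime q the group
  \<open>D \<inter> K\<close>, with \<open>D\<close> the product C(P) T, contains a subgroup whose
  order is the full q-part of |K|; so |K| divides the order of this intersection.\<close>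

lemma stability_group_le:
  assumes p: "Factorial_Ring.prime p" and P: "P \<lhd> G" "p_subgroup p P"
    and T: "sylow_in p (stability_group P) T"
  shows "stability_group P \<subseteq> centralizer_of P <#> T"
proof -
  define K where "K = stability_group P"
  have K: "subgroup K G"
    unfolding K_def using stability_group_normal normal_imp_subgroup by blast
  define C where "C = centralizer_of P"
  have PG: "P \<subseteq> carrier G" using P normal_subset by blast
  have C: "C \<lhd> G"
    unfolding normal_iff_conj_by
  proof (intro conjI ballI)
    show sC: "subgroup C G" unfolding C_def using subgroup_centralizer_of PG .
    fix g assume "g \<in> carrier G"
    then have "g \<in> normalizer_of P" using P(1) by (simp add: normal_iff_conj_by normalizer_of_def)
    then show "conj_by g ` C = C" unfolding C_def by (rule centralizer_of_conj_by[OF PG])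
  qed
  have pT: "p_subgroup p T" "T \<subseteq> K" and sT: "subgroup T G"
    using T by (auto simp: sylow_in_def p_subgroup_def K_def)
  define D where "D = C <#> T"
  have D: "subgroup D G"
    unfolding D_def using second_isomorphism_grp.normal_set_mult_subgroup C sT
    by (auto simp: second_isomorphism_grp_def second_isomorphism_grp_axioms_def)
  note up = set_mult_upper[OF normal_imp_subgroup[OF C] sT, folded D_def]
  have DK: "subgroup (D \<inter> K) G" using subgroups_Inter_pair D K by blast
  interpret K: finite_group "subgrp G K" using K by (rule finite_group_subgrp)
  have K0: "card K \<noteq> 0" using card_subgroup_pos[OF K] by simp
  have D0: "card (D \<inter> K) \<noteq> 0" using card_subgroup_pos[OF DK] by simp
  have "multiplicity q (card K) \<le> multiplicity q (card (D \<inter> K))"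
    if q: "Factorial_Ring.prime q" for q :: nat
  proof -
    obtain r where "order (subgrp G K) = q ^ multiplicity q (card K) * r"
      using multiplicity_dvd[of q "card K"] by (auto simp: order_def dvd_def)
    then obtain E where E: "subgroup E (subgrp G K)" "card E = q ^ multiplicity q (card K)"
      using Sylow.sylow_thm[OF q K.group_axioms _ K.finite_carrier] by blast
    have XK: "E \<subseteq> K" using subgroup.subset[OF E(1)] by simp
    have sX: "subgroup E G" using incl_subgroup[OF K E(1)] .
    have "\<exists>Y. subgroup Y G \<and> card Y = q ^ multiplicity q (card K) \<and> Y \<subseteq> D \<inter> K"
    proof (cases "q = p")
      case True
      \<comment> \<open>For q = p, a conjugate of \<open>E\<close> lies in \<open>T\<close>.\<close>
      have "p_subgroup p E" using E(2) sX True by (auto simp: p_subgroup_def)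
      then obtain g where g: "g \<in> K" "conj_by g ` E \<subseteq> T"
        using T XK unfolding sylow_in_def K_def by blast
      have gG: "g \<in> carrier G" using g K subgroup.mem_carrier by metis
      show ?thesis
      proof (intro exI conjI)
        show "subgroup (conj_by g ` E) G" using subgroup_conj_by gG sX .
        show "card (conj_by g ` E) = q ^ multiplicity q (card K)"
          using E(2) card_conj_by[OF gG subgroup.subset[OF sX]] by simp
        show "conj_by g ` E \<subseteq> D \<inter> K" using g pT up by blast
      qed
    next
      case False
      \<comment> \<open>For q different from p, the elements of \<open>E\<close> have order prime to
        p and lie in the stability group, so they centralize \<open>P\<close>.\<close>
      have "E \<subseteq> C"
      proof
        fix x assume x: "x \<in> E"
        have xG: "x \<in> carrier G" using x sX subgroup.mem_carrier by metis
        have "p_subgroup q E" using E sX by (auto simp: p_subgroup_def)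
        then obtain n where n: "x [^] (q ^ n) = \<one>" using p_subgroup_pow x by blast
        have "\<not> p dvd q ^ n"
          using False p q by (metis prime_dvd_power primes_dvd_imp_eq)
        then have "conj_by x y = y" if "y \<in> P" for y
          using p'_element_centralizes[OF p P(2) _ n _ P(1) _ that] x XK by (auto simp: K_def)
        then show "x \<in> C" using xG by (simp add: C_def centralizer_of_def)
      qed
      then show ?thesis using E(2) sX XK up by blast
    qed
    then have "q ^ multiplicity q (card K) dvd card (D \<inter> K)"
      using card_subgroup_dvd[OF _ DK] by metis
    then show ?thesis
      using D0 q prime_gt_1_nat[OF q] by (intro multiplicity_geI) auto
  qed
  then have "card K dvd card (D \<inter> K)"
    using multiplicity_le_imp_dvd[OF K0] by blast
  then have "card K \<le> card (D \<inter> K)" using D0 by (simp add: dvd_imp_le)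
  then have "D \<inter> K = K"
    using finite_subset_carrier[OF subgroup.subset[OF K]] by (intro card_seteq) auto
  then show ?thesis unfolding D_def C_def K_def by blast
qed

lemma cyclic_chief_factors_factorization:
  assumes p: "Factorial_Ring.prime p" and P: "P \<lhd> G" "p_subgroup p P"
    and cyc: "\<And>H K. \<lbrakk>chief_factor G H K; H \<subseteq> P\<rbrakk> \<Longrightarrow> cyclic_over H K"
    and T: "sylow_in p (carrier G) T" and h: "h \<in> carrier G"
  shows "\<exists>c\<in>centralizer_of P. \<exists>j\<in>normalizer_of T. h = c \<otimes> j"
proof -
  define K where "K = stability_group P"
  have nK: "K \<lhd> G" unfolding K_def by (rule stability_group_normal)
  note K = normal_imp_subgroup[OF nK]
  have pT: "p_subgroup p T" "subgroup T G" using T by (auto simp: sylow_in_def p_subgroup_def)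
  have "T \<subseteq> K"
    unfolding K_def using p_element_stability_group[OF p P(2) cyc] p_subgroup_pow[OF pT(1)]
      subgroup.mem_carrier[OF pT(2)] by blast
  then have "sylow_in p K T"
    using sylow_in_normal[OF p T subgroup_self K subgroup.subset[OF K]] nK
    by (simp add: normal_iff_conj_by inf.absorb1)
  moreover have "h \<in> normalizer_of K"
    using nK h by (simp add: normal_iff_conj_by normalizer_of_def)
  ultimately obtain k j where kj: "k \<in> K" "j \<in> normalizer_of T" "h = k \<otimes> j"
    using frattini[OF _ K] by blast
  \<comment> \<open>The \<open>T\<close>-part of \<open>k\<close> is absorbed into the other factor,
    since \<open>T\<close> normalizes itself.\<close>
  have "k \<in> centralizer_of P <#> T"
    using stability_group_le[OF p P] \<open>sylow_in p K T\<close> kj(1) unfolding K_def by blast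
  then obtain c t where ct: "c \<in> centralizer_of P" "t \<in> T" "k = c \<otimes> t" by (rule set_multE)
  note sN = subgroup_normalizer_of[OF subgroup.subset[OF pT(2)]]
  have t: "t \<in> normalizer_of T" using ct(2) subgroup_subset_normalizer_of[OF pT(2)] by blast
  have "c \<in> carrier G" "t \<in> carrier G" "j \<in> carrier G"
    using ct kj t by (auto simp: centralizer_of_def normalizer_of_def)
  then have "h = c \<otimes> (t \<otimes> j)" using kj ct by (simp add: m_assoc)
  then show ?thesis using ct(1) t kj(2) subgroup.m_closed[OF sN] by blast
qed

end

section \<open>Control of fusion\<close>

context finite_group
begin

lemma normalizer_of_conj_by:
  assumes A: "A \<subseteq> carrier G" and x: "x \<in> carrier G"
  shows "normalizer_of (conj_by x ` A) = conj_by x ` normalizer_of A"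
proof -
  have le: "conj_by y ` normalizer_of C \<subseteq> normalizer_of (conj_by y ` C)"
    if C: "C \<subseteq> carrier G" and y: "y \<in> carrier G" for C y
  proof (rule image_subsetI)
    fix n assume "n \<in> normalizer_of C"
    then have n: "n \<in> carrier G" "conj_by n ` C = C" by (auto simp: normalizer_of_def)
    have "y \<otimes> conj_by y n = n \<otimes> y"
      using n y by (simp add: conj_by_def flip: m_assoc)
    then have "conj_by (conj_by y n) ` conj_by y ` C = conj_by y ` conj_by n ` C"
      using n(1) C y by (simp add: image_conj_by_conj_by)
    then show "conj_by y n \<in> normalizer_of (conj_by y ` C)"
      using n y by (simp add: normalizer_of_def)
  qed
  have AG: "conj_by x ` A \<subseteq> carrier G" using A x by auto
  have "conj_by (inv x) ` normalizer_of (conj_by x ` A) \<subseteq> normalizer_of A"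
    using le[OF AG inv_closed[OF x]] image_conj_by_inv[OF x A refl] by simp
  then have "conj_by x ` conj_by (inv x) ` normalizer_of (conj_by x ` A)
      \<subseteq> conj_by x ` normalizer_of A"
    by (rule image_mono)
  moreover have "normalizer_of (conj_by x ` A) \<subseteq> carrier G" by (auto simp: normalizer_of_def)
  ultimately have "normalizer_of (conj_by x ` A) \<subseteq> conj_by x ` normalizer_of A"
    using x by (simp add: image_conj_by_conj_by image_conj_by_id)
  then show ?thesis using le[OF A x] by blast
qed

text \<open>A Sylow subgroup T of N(A) contains \<open>A\<close>, as \<open>A\<close> is normal in
  N(A). Some x moves T into \<open>S\<close>; the image is Sylow in N(A^x) and lies in S \<inter>
  N(A^x), so the two agree by maximality.\<close>

lemma fully_normalized_conjugate:
  assumes p: "Factorial_Ring.prime p" and S: "sylow_in p (carrier G) S"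
    and A: "subgroup A G" "A \<subseteq> S"
  shows "\<exists>x\<in>carrier G. conj_by x ` A \<subseteq> S \<and>
    sylow_in p (normalizer_of (conj_by x ` A)) (S \<inter> normalizer_of (conj_by x ` A))"
proof -
  have AG: "A \<subseteq> carrier G" using A subgroup.subset by blast
  have pS: "p_subgroup p S" "subgroup S G" using S by (auto simp: sylow_in_def p_subgroup_def)
  have pA: "p_subgroup p A" using p_subgroup_subset[OF p pS(1) A] .
  note N = subgroup_normalizer_of[OF AG]
  obtain T where T: "sylow_in p (normalizer_of A) T" using sylow_in_exists[OF p N] by blast
  then obtain n where "n \<in> normalizer_of A" "conj_by n ` A \<subseteq> T"
    using pA subgroup_subset_normalizer_of[OF A(1)] unfolding sylow_in_def by blast
  then have AT: "A \<subseteq> T" by (simp add: normalizer_of_def)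
  have pT: "p_subgroup p T" "subgroup T G" using T by (auto simp: sylow_in_def p_subgroup_def)
  then obtain x where x: "x \<in> carrier G" "conj_by x ` T \<subseteq> S"
    using S subgroup.subset[OF pT(2)] unfolding sylow_in_def by blast
  define N' where "N' = normalizer_of (conj_by x ` A)"
  have N'_eq: "N' = conj_by x ` normalizer_of A"
    unfolding N'_def using normalizer_of_conj_by[OF AG x(1)] .
  have sN': "subgroup N' G" unfolding N'_eq using subgroup_conj_by x(1) N .
  have T': "sylow_in p N' (conj_by x ` T)"
    unfolding N'_eq using sylow_in_conj_by[OF T x(1) N] .
  have "p_subgroup p (S \<inter> N')"
    using p_subgroup_subset[OF p pS(1) subgroups_Inter_pair[OF pS(2) sN']] by blast
  then have "S \<inter> N' = conj_by x ` T"
    using sylow_in_maximal[OF T'] x(2) T' sN' by (simp add: sylow_in_def)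
  then show ?thesis
    using T' x subset_trans[OF image_mono[OF AT] x(2)] unfolding N'_def by (intro bexI[of _ x]) auto
qed

(* Downward induction on |A|. With B a fully normalized conjugate of A, every g mapping A to B extends
   to the larger group S \<inter> N(A) up to an element h of N(B). If B is centric, h is
   treated by the hypothesis; otherwise the Frattini argument for C(B) in N(B) replaces h by an
   element normalizing B (S \<inter> C(B)) > B. *)
lemma sylow_normalizer_controls_fusion:
  assumes p: "Factorial_Ring.prime p" and S: "sylow_in p (carrier G) S"
    and centric: "\<And>B h. \<lbrakk>subgroup B G; B \<subseteq> S; S \<inter> centralizer_of B \<subseteq> B;
        sylow_in p (normalizer_of B) (S \<inter> normalizer_of B); h \<in> normalizer_of B\<rbrakk> \<Longrightarrow>
        \<exists>c\<in>centralizer_of B. \<exists>j\<in>normalizer_of (S \<inter> normalizer_of B). h = c \<otimes> j"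
    and A: "subgroup A G" "A \<subseteq> S" and g: "g \<in> carrier G" "conj_by g ` A \<subseteq> S"
  shows "\<exists>n\<in>normalizer_of S. \<forall>a\<in>A. conj_by g a = conj_by n a"
  using A g
proof (induction "card S - card A" arbitrary: A g rule: less_induct)
  case less
  \<comment> \<open>This property passes to smaller subgroups, to composites and to inverses, so
    \<open>g\<close> may be split into pieces that are controlled one by one.\<close>
  define ctl where
    "ctl = (\<lambda>A g. \<exists>n\<in>normalizer_of S. \<forall>a\<in>A. conj_by g a = conj_by n a)"
  have pS: "p_subgroup p S" "subgroup S G" using S by (auto simp: sylow_in_def p_subgroup_def)
  note SG = subgroup.subset[OF pS(2)]
  note sN = subgroup_normalizer_of[OF SG]
  have NG: "n \<in> carrier G" if "n \<in> normalizer_of S" for n using that by (simp add: normalizer_of_def)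
  have ctl_mono: "ctl A g" if "ctl B g" "A \<subseteq> B" for A B g
    using that unfolding ctl_def by blast
  have ctl_mult: "ctl A (g \<otimes> h)"
    if g: "ctl A g" "g \<in> carrier G" and h: "ctl (conj_by g ` A) h" "h \<in> carrier G"
      and A: "A \<subseteq> carrier G" for A g h
  proof -
    obtain n where n: "n \<in> normalizer_of S" "\<And>a. a \<in> A \<Longrightarrow> conj_by g a = conj_by n a"
      using g(1) unfolding ctl_def by blast
    obtain m where m: "m \<in> normalizer_of S" "\<And>a. a \<in> A \<Longrightarrow> conj_by h (conj_by g a) = conj_by m (conj_by g a)"
      using h(1) unfolding ctl_def by blast
    have "conj_by (g \<otimes> h) a = conj_by (n \<otimes> m) a" if a: "a \<in> A" for a
    proof -
      have aG: "a \<in> carrier G" using a A by blast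
      have "conj_by (g \<otimes> h) a = conj_by h (conj_by g a)" using g h aG by (simp add: conj_by_conj_by)
      also have "\<dots> = conj_by m (conj_by n a)" using m(2)[OF a] n(2)[OF a] by simp
      also have "\<dots> = conj_by (n \<otimes> m) a" using aG NG n(1) m(1) by (simp add: conj_by_conj_by)
      finally show ?thesis .
    qed
    then show ?thesis unfolding ctl_def using subgroup.m_closed[OF sN n(1) m(1)] by blast
  qed
  have ctl_inv: "ctl (conj_by g ` A) (inv g)"
    if g: "ctl A g" "g \<in> carrier G" and A: "A \<subseteq> carrier G" for A g
  proof -
    obtain n where n: "n \<in> normalizer_of S" "\<And>a. a \<in> A \<Longrightarrow> conj_by g a = conj_by n a"
      using g(1) unfolding ctl_def by blast
    have "conj_by (inv g) (conj_by g a) = conj_by (inv n) (conj_by g a)" if a: "a \<in> A" for a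
    proof -
      have aG: "a \<in> carrier G" using a A by blast
      then show ?thesis using n(2)[OF a] NG[OF n(1)] g(2) by (metis conj_by_inv_cancel(1))
    qed
    then show ?thesis unfolding ctl_def using subgroup.m_inv_closed[OF sN n(1)] by blast
  qed
  have IH: "ctl U h"
    if "card A < card U" "subgroup U G" "U \<subseteq> S" "h \<in> carrier G" "conj_by h ` U \<subseteq> S" for U h
  proof -
    have "card U \<le> card S"
      using that finite_subset_carrier[OF SG] card_mono by blast
    then show ?thesis unfolding ctl_def using that by (intro less.hyps) auto
  qed
  note AG = subgroup.subset[OF less.prems(1)]
  show ?case
  proof (cases "A = S")
    case True
    then have "g \<in> normalizer_of S"
      using less.prems conj_by_subset_eq[of g S] SG by (simp add: normalizer_of_def)
    then show ?thesis by blast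
  next
    case False
    \<comment> \<open>Normalizers grow in the p-group \<open>S\<close>; so the induction hypothesis
      applies to S \<inter> N(B).\<close>
    have grow: "card A < card (S \<inter> normalizer_of B)"
      if B: "subgroup B G" "B \<subseteq> S" "card B = card A" for B
    proof -
      have "card A < card S"
        using False less.prems finite_subset_carrier[OF SG] by (intro psubset_card_mono) auto
      then have "B \<subset> S" using B by auto
      then obtain H where H: "subgroup H G" "H \<subseteq> S" "H \<subseteq> normalizer_of B" "card H = p * card B"
        using p_subgroup_normalizer_step[OF p pS(1) B(1)] by blast
      have "card B < card H" using H(4) prime_gt_1_nat[OF p] card_subgroup_pos[OF B(1)] by simp
      also have "\<dots> \<le> card (S \<inter> normalizer_of B)"
        using H finite_subset_carrier[OF SG] by (intro card_mono) auto
      finally show ?thesis using B by simp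
    qed
    obtain x where x: "x \<in> carrier G" "conj_by x ` A \<subseteq> S"
        "sylow_in p (normalizer_of (conj_by x ` A)) (S \<inter> normalizer_of (conj_by x ` A))"
      using fully_normalized_conjugate[OF p S less.prems(1,2)] by blast
    define B where "B = conj_by x ` A"
    have BS: "B \<subseteq> S" using x by (simp add: B_def)
    have sB: "subgroup B G" unfolding B_def using subgroup_conj_by x(1) less.prems(1) .
    note BG = subgroup.subset[OF sB]
    have cB: "card B = card A" unfolding B_def using card_conj_by x(1) AG .
    define T where "T = S \<inter> normalizer_of B"
    note NB = subgroup_normalizer_of[OF BG]
    have T: "sylow_in p (normalizer_of B) T" using x(3) unfolding T_def B_def .
    have sT: "subgroup T G" unfolding T_def using subgroups_Inter_pair pS(2) NB by blast
    have BT: "B \<subseteq> T" unfolding T_def using BS subgroup_subset_normalizer_of[OF sB] by blast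
    have local: "ctl B h" if h: "h \<in> normalizer_of B" for h
    proof (cases "S \<inter> centralizer_of B \<subseteq> B")
      case True
      obtain c j where cj: "c \<in> centralizer_of B" "j \<in> normalizer_of T" "h = c \<otimes> j"
        using centric[OF sB BS True _ h] T unfolding T_def by blast
      have G: "c \<in> carrier G" "j \<in> carrier G" "conj_by j ` T = T"
        using cj by (auto simp: centralizer_of_def normalizer_of_def)
      have "ctl T j"
        using grow[OF sB BS cB] sT G by (intro IH) (auto simp: T_def)
      then have "ctl B j" using ctl_mono BT by blast
      \<comment> \<open>In h = c j the factor \<open>c\<close> acts before \<open>j\<close> and
        fixes B pointwise, so \<open>h\<close> and \<open>j\<close> agree on B.\<close>
      moreover have "conj_by h b = conj_by j b" if b: "b \<in> B" for b
        using cj b G BG by (simp add: centralizer_of_def subset_iff flip: conj_by_conj_by)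
      ultimately show ?thesis unfolding ctl_def by simp
    next
      case False
      define C where "C = centralizer_of B"
      define U where "U = S \<inter> C"
      have C: "subgroup C G" unfolding C_def using subgroup_centralizer_of BG .
      have CN: "C \<subseteq> normalizer_of B"
        by (auto simp: C_def centralizer_of_def normalizer_of_def image_iff)
      have nC: "conj_by n ` C = C" if "n \<in> normalizer_of B" for n
        unfolding C_def using centralizer_of_conj_by[OF BG that] .
      have sU: "subgroup U G" unfolding U_def using subgroups_Inter_pair pS(2) C by blast
      have "T \<inter> C = U" using CN by (auto simp: T_def U_def)
      then have U: "sylow_in p C U"
        using sylow_in_normal[OF p T NB C CN nC] by simp
      have hG: "h \<in> carrier G" using h by (simp add: normalizer_of_def)
      have "h \<in> normalizer_of C" using nC[OF h] hG by (simp add: normalizer_of_def)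
      then obtain c j where cj: "c \<in> C" "j \<in> normalizer_of U" "h = c \<otimes> j"
        using frattini[OF U C] by blast
      have G: "c \<in> carrier G" "j \<in> carrier G" and jU: "conj_by j ` U = U"
        using cj by (auto simp: C_def centralizer_of_def normalizer_of_def)
      have "j = inv c \<otimes> h" using cj G by (simp flip: m_assoc)
      moreover have "inv c \<in> normalizer_of B" using cj(1) CN subgroup.m_inv_closed[OF NB] by blast
      ultimately have "j \<in> normalizer_of B" using h subgroup.m_closed[OF NB] by blast
      then have jB: "conj_by j ` B = B" by (simp add: normalizer_of_def)
      \<comment> \<open>\<open>j\<close> normalizes both B and U, hence their product. The product
        is a subgroup because U centralizes B, and is larger than B because B is not centric; so the
        induction hypothesis controls \<open>j\<close> on V.\<close>
      define V where "V = B <#> U"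
      have comm: "u \<otimes> b = b \<otimes> u" if "b \<in> B" "u \<in> U" for u b
      proof -
        have "conj_by u b = b" using that by (auto simp: U_def C_def centralizer_of_def)
        then show ?thesis
          using conj_by_eq_iff[of u b] subsetD[OF BG that(1)] subsetD[OF subgroup.subset[OF sU] that(2)]
          by simp
      qed
      have sV: "subgroup V G"
      proof -
        have "B <#> U = U <#> B"
        proof (intro equalityI subsetI)
          show "v \<in> U <#> B" if "v \<in> B <#> U" for v
            using that comm by (elim set_multE) (metis mem_set_mult)
          show "v \<in> B <#> U" if "v \<in> U <#> B" for v
            using that comm by (elim set_multE) (metis mem_set_mult)
        qed
        show ?thesis
          unfolding V_def
        proof (rule subgroupI)
          show "B <#> U \<subseteq> carrier G" by (rule set_mult_least[OF subgroup_self BG subgroup.subset[OF sU]])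
          show "B <#> U \<noteq> {}" using set_mult_upper(1)[OF sB sU] subgroup.one_closed[OF sB] by blast
          fix v assume "v \<in> B <#> U"
          then obtain b u where bu: "b \<in> B" "u \<in> U" "v = b \<otimes> u" by (rule set_multE)
          have buG: "b \<in> carrier G" "u \<in> carrier G"
            using bu BG subgroup.subset[OF sU] by auto
          have "inv v = inv b \<otimes> inv u"
            using comm[OF bu(1,2)] bu(3) buG by (metis inv_mult_group)
          then show "inv v \<in> B <#> U"
            using bu subgroup.m_inv_closed[OF sB] subgroup.m_inv_closed[OF sU] mem_set_mult by blast
          fix w assume "w \<in> B <#> U"
          then obtain b' u' where bu': "b' \<in> B" "u' \<in> U" "w = b' \<otimes> u'" by (rule set_multE)
          have buG': "b' \<in> carrier G" "u' \<in> carrier G"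
            using bu' BG subgroup.subset[OF sU] by auto
          have "v \<otimes> w = b \<otimes> (u \<otimes> b') \<otimes> u'" using bu bu' buG buG' by (simp add: m_assoc)
          also have "\<dots> = (b \<otimes> b') \<otimes> (u \<otimes> u')"
            using comm[OF bu'(1) bu(2)] buG buG' by (simp add: m_assoc)
          finally show "v \<otimes> w \<in> B <#> U"
            using bu bu' subgroup.m_closed[OF sB] subgroup.m_closed[OF sU] mem_set_mult by metis
        qed
      qed
      have VS: "V \<subseteq> S"
        unfolding V_def using BS by (intro set_mult_least[OF pS(2)]) (auto simp: U_def)
      note up = set_mult_upper[OF sB sU, folded V_def]
      have "B \<subset> V" using False up by (auto simp: U_def C_def)
      then have "card A < card V"
        using finite_subset_carrier[OF subgroup.subset[OF sV]] cB psubset_card_mono by metis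
      moreover have "conj_by j ` V \<subseteq> V"
      proof (rule image_subsetI)
        fix v assume "v \<in> V"
        then obtain b u where bu: "b \<in> B" "u \<in> U" "v = b \<otimes> u" unfolding V_def by (rule set_multE)
        have "b \<in> carrier G" "u \<in> carrier G"
          using bu BG subgroup.subset[OF sU] by auto
        then have "conj_by j v = conj_by j b \<otimes> conj_by j u" using bu(3) G by (simp add: conj_by_mult)
        moreover have "conj_by j b \<in> B" "conj_by j u \<in> U" using bu jB jU by blast+
        ultimately show "conj_by j v \<in> V" unfolding V_def using mem_set_mult by blast
      qed
      ultimately have "ctl V j" using IH[OF _ sV VS G(2)] VS by blast
      then have "ctl B j" using ctl_mono up by blast
      moreover have "conj_by h b = conj_by j b" if b: "b \<in> B" for b
        using cj b G BG by (simp add: C_def centralizer_of_def subset_iff flip: conj_by_conj_by)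
      ultimately show ?thesis unfolding ctl_def by simp
    qed
    \<comment> \<open>\<open>y\<close> moves S \<inter> N(A') to a p-subgroup of N(B), which some h
      in N(B) moves on into T \<le> S. So y h is controlled on a group larger than A', and
      \<open>local\<close> controls the correction h^-1 on B.\<close>
    have key: "ctl A' y"
      if A': "subgroup A' G" "A' \<subseteq> S" and y: "y \<in> carrier G" "conj_by y ` A' = B" for A' y
    proof -
      note AG' = subgroup.subset[OF A'(1)]
      have cA': "card A' = card A" using y cB card_conj_by[OF y(1) AG'] by simp
      define W where "W = S \<inter> normalizer_of A'"
      have sW: "subgroup W G"
        unfolding W_def using subgroups_Inter_pair pS(2) subgroup_normalizer_of[OF AG'] by blast
      have "p_subgroup p W" using p_subgroup_subset[OF p pS(1) sW] by (simp add: W_def)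
      then have pW: "p_subgroup p (conj_by y ` W)" using p_subgroup_conj_by y(1) by blast
      have "conj_by y ` W \<subseteq> normalizer_of B"
        using normalizer_of_conj_by[OF AG' y(1)] y(2) by (auto simp: W_def)
      then obtain h where h: "h \<in> normalizer_of B" "conj_by h ` conj_by y ` W \<subseteq> T"
        using T pW unfolding sylow_in_def by blast
      have hG: "h \<in> carrier G" and hB: "conj_by h ` B = B" using h by (auto simp: normalizer_of_def)
      have "conj_by (y \<otimes> h) ` W \<subseteq> S"
        using h(2) y(1) hG subgroup.subset[OF sW] by (auto simp: image_conj_by_conj_by T_def)
      then have "ctl W (y \<otimes> h)"
        using grow[OF A' cA'] sW y(1) hG by (intro IH) (auto simp: W_def)
      moreover have "A' \<subseteq> W" unfolding W_def using A' subgroup_subset_normalizer_of by blast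
      ultimately have "ctl A' (y \<otimes> h)" using ctl_mono by blast
      moreover have "conj_by (y \<otimes> h) ` A' = B"
        using y hG hB AG' by (simp flip: image_conj_by_conj_by)
      moreover have "ctl B (inv h)" using local subgroup.m_inv_closed[OF NB h(1)] by blast
      ultimately have "ctl A' (y \<otimes> h \<otimes> inv h)"
        using ctl_mult[of A' "y \<otimes> h" "inv h"] y(1) hG AG' by simp
      then show ?thesis using y hG by (simp add: m_assoc)
    qed
    have gG: "g \<in> carrier G" by fact
    \<comment> \<open>Both A and its image under \<open>g\<close> are conjugate to B, by
      \<open>x\<close> and by y = g^-1 x. Then g = x y^-1 is composed of two maps that
      \<open>key\<close> controls.\<close>
    define y where "y = inv g \<otimes> x"
    have yG: "y \<in> carrier G" using gG x by (simp add: y_def)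
    have AgG: "conj_by g ` A \<subseteq> carrier G" using AG gG by auto
    have gy: "g \<otimes> y = x" using gG x by (simp add: y_def flip: m_assoc)
    have yB: "conj_by y ` conj_by g ` A = B"
      using gG yG AG gy by (simp add: image_conj_by_conj_by B_def)
    have "ctl (conj_by g ` A) y"
      using subgroup_conj_by[OF gG less.prems(1)] less.prems(4) yG yB by (rule key)
    then have "ctl B (inv y)" using ctl_inv[OF _ yG AgG] yB by simp
    moreover have "ctl A x" using key less.prems(1,2) x(1) B_def by blast
    ultimately have "ctl A (x \<otimes> inv y)"
      using ctl_mult[of A x "inv y"] x(1) yG AG by (simp add: B_def)
    moreover have "x \<otimes> inv y = g" using gy gG yG by (simp add: m_assoc flip: gy)
    ultimately show ?thesis by (simp add: ctl_def)
  qed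
qed

lemma chief_series_exists:
  assumes "M \<lhd> G"
  shows "\<exists>n T. T 0 = {\<one>} \<and> T (n::nat) = M \<and> (\<forall>i\<le>n. T i \<lhd> G \<and> T i \<subseteq> M) \<and>
    (\<forall>i<n. chief_factor G (T (Suc i)) (T i))"
  using assms
proof (induction "card M" arbitrary: M rule: less_induct)
  case less
  show ?case
  proof (cases "M = {\<one>}")
    case True
    then show ?thesis
      using less.prems by (intro exI[of _ 0] exI[of _ "\<lambda>_. M"]) simp
  next
    case False
    obtain K where K: "chief_factor G M K"
      using chief_factor_exists less.prems False by blast
    then have K': "K \<lhd> G" "K \<subset> M" by (auto simp: chief_factor_def)
    have "card K < card M"
      using K' finite_subset_carrier[OF normal_subset[OF less.prems]] psubset_card_mono by blast
    then obtain n T where T: "T 0 = {\<one>}" "T (n::nat) = K"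
        "\<And>i. i \<le> n \<Longrightarrow> T i \<lhd> G \<and> T i \<subseteq> K" "\<And>i. i < n \<Longrightarrow> chief_factor G (T (Suc i)) (T i)"
      using less.hyps K'(1) by metis
    define T' where "T' = T(Suc n := M)"
    have "T' 0 = {\<one>}" "T' (Suc n) = M" using T(1) by (auto simp: T'_def)
    moreover have "T' i \<lhd> G \<and> T' i \<subseteq> M" if "i \<le> Suc n" for i
      using T(3)[of i] that K'(2) less.prems by (cases "i = Suc n") (auto simp: T'_def)
    moreover have "chief_factor G (T' (Suc i)) (T' i)" if "i < Suc n" for i
      using T(2) T(4)[of i] that K by (cases "i = n") (auto simp: T'_def)
    ultimately show ?thesis by blast
  qed
qed

end

section \<open>The supersolvable series\<close>

context finite_group
begin

text \<open>The 2-eternal property applied to a subgroup \<open>N\<close>. Its p-core P lies in T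
  \<le> S, so the subgroups of P of order |D| are related to \<open>G\<close> by hypothesis and to
  \<open>N\<close> by heredity.\<close>

lemma two_eternal_normalizer_chief_factor:
  assumes R: "two_eternal R" and p: "Factorial_Ring.prime p"
    and S: "p_subgroup p S" and D: "subgroup D G" "D \<subseteq> S" "1 < card D"
    and RD: "\<And>H. \<lbrakk>subgroup H G; H \<subseteq> S; card H = card D\<rbrakk> \<Longrightarrow> R H G"
    and R4: "\<lbrakk>\<not> comm_group (subgrp G S); card S > 4; p = 2\<rbrakk> \<Longrightarrow>
      \<forall>H. subgroup H G \<and> H \<subseteq> S \<and> cyclic_group (subgrp G H) \<and> card H = 4 \<longrightarrow> R H G"
    and N: "subgroup N G" and T: "sylow_in p N T" "T \<subseteq> S"
    and P: "P = p_core p (subgrp G N)" "card D < card P"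
    and c: "chief_factor (subgrp G N) H K" "H \<subseteq> P"
  shows "finite_group.cyclic_over (subgrp G N) H K"
proof -
  interpret N: finite_group "subgrp G N" using N by (rule finite_group_subgrp)
  have "N.sylow_in p (carrier (subgrp G N)) T"
    using T(1) N unfolding N.sylow_in_def sylow_in_def
    by (auto simp: p_subgroup_subgrp conj_by_subgrp cong: image_cong)
  then have "P \<subseteq> T" unfolding P(1) by (rule N.p_core_props(4)[OF p])
  then have PS: "P \<subseteq> S" using T(2) by blast
  have pP: "p_subgroup p P" "P \<subseteq> N"
    using N.p_core_props(2)[OF p] p_subgroup_subgrp[OF N] unfolding P(1) by auto
  then have sP: "subgroup P G" by (simp add: p_subgroup_def)
  have "p_subgroup p D" using p_subgroup_subset[OF p S D(1,2)] .
  then obtain d where d: "card D = p ^ d" by (auto simp: p_subgroup_def)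
  have one_le: "card {\<one>} \<le> p ^ d" using prime_gt_0_nat[OF p] by (simp add: Suc_leI)
  have one_P: "{\<one>} \<subseteq> P" using subgroup.one_closed[OF sP] by simp
  \<comment> \<open>\<open>D\<close> may lie outside P. Only its order matters, and P has subgroups
    of every power of p up to |P|.\<close>
  obtain D' where D': "subgroup D' G" "D' \<subseteq> P" "card D' = card D"
    using p_subgroup_intermediate[OF p pP(1) triv_subgroup one_P one_le] P(2) d by auto
  have hered: "R L (subgrp G N)" if "subgroup L G" "L \<subseteq> P" "R L G" for L
  proof -
    have "subgroup L (subgrp G N)" using subgroup_incl[OF that(1) N] that(2) pP(2) by blast
    then show ?thesis
      using R[unfolded two_eternal_def, rule_format, of G] group_axioms finite_carrier N that(3)
      by blast
  qed
  have subP: "subgroup L (subgrp (subgrp G N) P) \<longleftrightarrow> subgroup L G \<and> L \<subseteq> P" for L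
    using incl_subgroup[OF sP, of L] subgroup_incl[of L P] sP subgroup.subset[of L "subgrp G P"] by auto
  have "p dvd order (subgrp G N)"
  proof -
    obtain k where k: "card P = p ^ k" using pP(1) by (auto simp: p_subgroup_def)
    then have "p dvd card P" using P(2) D(3) by (cases k) auto
    then show ?thesis using card_subgroup_dvd[OF sP N pP(2)] dvd_trans by (simp add: order_def) blast
  qed
  moreover have "subgroup D' (subgrp (subgrp G N) P)" using D' subP by blast
  moreover have "1 < card D'" "card D' < card P" using D' D(3) P(2) by auto
  moreover have "R L (subgrp G N)" if "subgroup L (subgrp (subgrp G N) P)" "card L = card D'" for L
    using that hered RD[of L] subP PS D' by auto
  moreover have "R L (subgrp G N)"
    if nc: "\<not> comm_group (subgrp (subgrp G N) P)" "card P > 4" "card D' = 2"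
      and L: "subgroup L (subgrp (subgrp G N) P)" "cyclic_group (subgrp (subgrp G N) L)" "card L = 4"
    for L
  proof -
    \<comment> \<open>The condition on cyclic subgroups of order 4 is inherited: if P is non-abelian
      of order greater than 4, then so is \<open>S\<close>, and |D'| = 2 is a nontrivial power of p,
      so p = 2.\<close>
    have sS: "subgroup S G" using S by (simp add: p_subgroup_def)
    have "\<not> comm_group (subgrp G S)"
    proof
      assume "comm_group (subgrp G S)"
      then interpret S: comm_group "subgrp G S" .
      have "comm_group (subgrp G P)"
        using S.m_comm PS by (intro group.group_comm_groupI subgroup_imp_group sP) auto
      then show False using nc(1) by simp
    qed
    moreover have "card S > 4"
      using nc(2) card_mono[OF finite_subset_carrier[OF subgroup.subset[OF sS]] PS] by simp
    moreover have "p = 2"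
    proof -
      have "p dvd card D" using d D(3) by (cases d) auto
      then have "p dvd 2" using D'(3) nc(3) by simp
      then show ?thesis using p two_is_prime_nat primes_dvd_imp_eq by blast
    qed
    ultimately show ?thesis using R4 hered L subP PS by auto
  qed
  ultimately have "P \<subseteq> supersolvable_hypercenter (subgrp G N)"
    using R[unfolded two_eternal_def Let_def, THEN spec, of "subgrp G N", THEN mp, THEN conjunct2,
        THEN spec, of p, folded P(1)] N.group_axioms N.finite_carrier p
    by blast
  then show ?thesis using N.hypercenter_chief_factor_cyclic c by blast
qed

text \<open>An abelian subgroup of \<open>S\<close> containing \<open>B\<close> centralizes
  \<open>B\<close>, so it lies in S \<inter> C(B) \<le> B and equals \<open>B\<close>. If |B| \<le>
  |D|, then \<open>B\<close> has an overgroup of order |D|, which forces |B| = |D|; then it has one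
  of order p|D|, a contradiction. This is where both orders enter.\<close>

lemma centric_card_gt:
  assumes p: "Factorial_Ring.prime p" and S: "p_subgroup p S"
    and D: "subgroup D G" "D \<subseteq> S" "card D < card S"
    and ab: "\<And>H. \<lbrakk>subgroup H G; H \<subseteq> S; card H = card D \<or> card H = p * card D\<rbrakk> \<Longrightarrow>
      comm_group (subgrp G H)"
    and B: "subgroup B G" "B \<subseteq> S" "S \<inter> centralizer_of B \<subseteq> B"
  shows "card D < card B"
proof (rule ccontr)
  assume "\<not> card D < card B"
  have absorb: "H = B"
    if "subgroup H G" "H \<subseteq> S" "B \<subseteq> H" "card H = card D \<or> card H = p * card D" for H
  proof -
    interpret H: comm_group "subgrp G H" using ab that by blast
    have HG: "x \<in> carrier G" if "x \<in> H" for x using that \<open>subgroup H G\<close> subgroup.mem_carrier by metis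
    have "x \<in> centralizer_of B" if x: "x \<in> H" for x
    proof -
      have "b \<otimes> x = x \<otimes> b" if "b \<in> B" for b
        using H.m_comm[of b x] x that \<open>B \<subseteq> H\<close> by auto
      then show ?thesis
        using HG x \<open>B \<subseteq> H\<close> by (auto simp: centralizer_of_def conj_by_eq_iff subset_iff)
    qed
    then show ?thesis using B(3) that by blast
  qed
  have "p_subgroup p D" using p_subgroup_subset[OF p S D(1,2)] .
  then obtain d where d: "card D = p ^ d" by (auto simp: p_subgroup_def)
  then have "card B \<le> p ^ d" "p ^ d \<le> card S" using D(3) \<open>\<not> card D < card B\<close> by auto
  then obtain H where "subgroup H G" "B \<subseteq> H" "H \<subseteq> S" "card H = p ^ d"
    using p_subgroup_intermediate[OF p S B(1,2)] by blast
  then have cB: "card B = card D" using absorb[of H] d by simp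
  then have "B \<subset> S" using B(2) D(3) by auto
  then obtain L where L: "subgroup L G" "B \<subseteq> L" "L \<subseteq> S" "card L = p * card B"
    using p_subgroup_normalizer_step[OF p S B(1)] by blast
  then have "L = B" using absorb[of L] cB by simp
  then show False using L(4) card_subgroup_pos[OF B(1)] prime_gt_1_nat[OF p] by simp
qed

lemma p_subgroup_le_normalizer_core:
  assumes p: "Factorial_Ring.prime p" and B: "p_subgroup p B"
  shows "B \<subseteq> p_core p (subgrp G (normalizer_of B))"
proof -
  have sB: "subgroup B G" using B by (simp add: p_subgroup_def)
  note N = subgroup_normalizer_of[OF subgroup.subset[OF sB]]
  note BN = subgroup_subset_normalizer_of[OF sB]
  interpret N: finite_group "subgrp G (normalizer_of B)" using N by (rule finite_group_subgrp)
  have "N.conj_by g ` B = B" if "g \<in> normalizer_of B" for g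
    using conj_by_subgrp[OF N that] that by (simp add: normalizer_of_def)
  then have "B \<lhd> subgrp G (normalizer_of B)"
    unfolding N.normal_iff_conj_by using subgroup_incl[OF sB N BN] by simp
  then show ?thesis
    using N.p_core_props(3)[OF p] p_subgroup_subgrp[OF N] B BN by blast
qed

text \<open>\<open>S\<close> is normal in its normalizer, so it is contained in a Sylow subgroup of
  N(S), which is no larger because \<open>S\<close> is already Sylow in \<open>G\<close>.\<close>

lemma sylow_in_normalizer:
  assumes p: "Factorial_Ring.prime p" and S: "sylow_in p (carrier G) S"
  shows "sylow_in p (normalizer_of S) S"
proof -
  have pS: "p_subgroup p S" and sS: "subgroup S G" using S by (auto simp: sylow_in_def p_subgroup_def)
  obtain T where T: "sylow_in p (normalizer_of S) T"
    using sylow_in_exists[OF p subgroup_normalizer_of[OF subgroup.subset[OF sS]]] by blast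
  then obtain n where "n \<in> normalizer_of S" "conj_by n ` S \<subseteq> T"
    using pS subgroup_subset_normalizer_of[OF sS] unfolding sylow_in_def by blast
  then have "S \<subseteq> T" by (simp add: normalizer_of_def)
  moreover have "p_subgroup p T" "T \<subseteq> carrier G"
    using T by (auto simp: sylow_in_def p_subgroup_def dest: subgroup.subset)
  ultimately have "T = S" using sylow_in_maximal[OF S] subgroup_self by blast
  then show ?thesis using T by simp
qed

end

theorem theorem3p5:
  fixes R :: "'a set \<Rightarrow> 'a monoid \<Rightarrow> bool"
    and G :: "'a monoid" and p :: nat and S :: "'a set"
  assumes "two_eternal R"
    and "group G" and "finite (carrier G)"
    and "Factorial_Ring.prime p" and "p dvd Coset.order G"
    and "sylow_subgroup p G S"
    and "\<exists>D. subgroup D (subgrp G S) \<and> 1 < card D \<and> card D < card S \<and>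
      (\<forall>H. subgroup H (subgrp G S) \<and> (card H = card D \<or> card H = p * card D)
         \<longrightarrow> comm_group (subgrp G H)) \<and>
      (\<forall>H. subgroup H (subgrp G S) \<and> card H = card D \<longrightarrow> R H G) \<and>
      (\<not> comm_group (subgrp G S) \<and> card S > 4 \<and> p = 2 \<longrightarrow>
         (\<forall>H. subgroup H (subgrp G S) \<and> cyclic_group (subgrp G H) \<and> card H = 4 \<longrightarrow> R H G))"
  shows "supersolvable_fusion (subgrp G S) (fusion_system G S)"
proof -
  interpret finite_group G
    using assms(2,3) by (simp add: finite_group.intro finite_group_axioms.intro)
  note p = assms(4)
  have S: "sylow_in p (carrier G) S" using sylow_subgroup_sylow_in p assms(6) .
  then have pS: "p_subgroup p S" and sS: "subgroup S G" by (auto simp: sylow_in_def p_subgroup_def)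
  have subS: "subgroup H (subgrp G S) \<longleftrightarrow> subgroup H G \<and> H \<subseteq> S" for H
    using incl_subgroup[OF sS, of H] subgroup_incl[of H S] sS subgroup.subset[of H "subgrp G S"] by auto
  obtain D where D: "subgroup D G" "D \<subseteq> S" "1 < card D" "card D < card S"
    and ab: "\<And>H. \<lbrakk>subgroup H G; H \<subseteq> S; card H = card D \<or> card H = p * card D\<rbrakk> \<Longrightarrow>
      comm_group (subgrp G H)"
    and RD: "\<And>H. \<lbrakk>subgroup H G; H \<subseteq> S; card H = card D\<rbrakk> \<Longrightarrow> R H G"
    and R4: "\<lbrakk>\<not> comm_group (subgrp G S); card S > 4; p = 2\<rbrakk> \<Longrightarrow>
      \<forall>H. subgroup H G \<and> H \<subseteq> S \<and> cyclic_group (subgrp G H) \<and> card H = 4 \<longrightarrow> R H G"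
    using assms(7) unfolding subS by blast
  \<comment> \<open>Used for centric B, where it yields the factorization of N(B), and for B = S,
    where it makes the factors of the final series cyclic.\<close>
  have chief: "finite_group.cyclic_over (subgrp G (normalizer_of B)) H K"
    if B: "subgroup B G" "B \<subseteq> S" "card D < card B"
      and T: "sylow_in p (normalizer_of B) T" "T \<subseteq> S"
      and c: "chief_factor (subgrp G (normalizer_of B)) H K"
        "H \<subseteq> p_core p (subgrp G (normalizer_of B))" for B T H K
  proof (rule two_eternal_normalizer_chief_factor[OF assms(1) p pS D(1-3) RD R4 _ T refl _ c])
    note N = subgroup_normalizer_of[OF subgroup.subset[OF B(1)]]
    interpret N: finite_group "subgrp G (normalizer_of B)" using N by (rule finite_group_subgrp)
    show "subgroup (normalizer_of B) G" by (rule N)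
    have "p_subgroup p B" using p_subgroup_subset[OF p pS B(1,2)] .
    then have "B \<subseteq> p_core p (subgrp G (normalizer_of B))"
      by (rule p_subgroup_le_normalizer_core[OF p])
    moreover have "finite (p_core p (subgrp G (normalizer_of B)))"
      using N.finite_subset_carrier[OF N.normal_subset[OF N.p_core_props(1)[OF p]]] .
    ultimately show "card D < card (p_core p (subgrp G (normalizer_of B)))"
      by (intro less_le_trans[OF B(3)] card_mono)
  qed
  have control: "\<exists>n\<in>normalizer_of S. \<forall>a\<in>A. conj_by g a = conj_by n a"
    if A: "subgroup A G" "A \<subseteq> S" and g: "g \<in> carrier G" "conj_by g ` A \<subseteq> S" for A g
  proof (rule sylow_normalizer_controls_fusion[OF p S _ A g])
    fix B h
    assume B: "subgroup B G" "B \<subseteq> S" "S \<inter> centralizer_of B \<subseteq> B"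
      and T: "sylow_in p (normalizer_of B) (S \<inter> normalizer_of B)" and h: "h \<in> normalizer_of B"
    define T where "T = S \<inter> normalizer_of B"
    note N = subgroup_normalizer_of[OF subgroup.subset[OF B(1)]]
    interpret N: finite_group "subgrp G (normalizer_of B)" using N by (rule finite_group_subgrp)
    define P where "P = p_core p (subgrp G (normalizer_of B))"
    have BD: "card D < card B" using centric_card_gt[OF p pS D(1,2,4) ab B] .
    have P: "P \<lhd> subgrp G (normalizer_of B)" "N.p_subgroup p P"
      unfolding P_def using N.p_core_props[OF p] by blast+
    have cyc: "N.cyclic_over H K" if "chief_factor (subgrp G (normalizer_of B)) H K" "H \<subseteq> P" for H K
      using chief[OF B(1,2) BD T _ that(1)] that(2) unfolding P_def by blast
    have "N.sylow_in p (carrier (subgrp G (normalizer_of B))) T"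
      using T N unfolding N.sylow_in_def sylow_in_def T_def
      by (auto simp: p_subgroup_subgrp conj_by_subgrp cong: image_cong)
    then obtain c j where cj: "c \<in> N.centralizer_of P" "j \<in> N.normalizer_of T" "h = c \<otimes>\<^bsub>G\<^esub> j"
      using N.cyclic_chief_factors_factorization[OF p P cyc, of T h] h by auto
    have "j \<in> normalizer_of T"
      using cj(2) normalizer_of_subgrp[OF N, of T] by (auto simp: T_def)
    moreover have "c \<in> centralizer_of B"
    proof -
      \<comment> \<open>\<open>c\<close> centralizes P, hence also the normal p-subgroup B of N(B),
        which lies in the p-core P.\<close>
      have "B \<subseteq> P"
        unfolding P_def using p_subgroup_le_normalizer_core[OF p] p_subgroup_subset[OF p pS B(1,2)] .
      then show ?thesis
        using cj(1) subgroup.mem_carrier[OF N]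
        by (auto simp: N.centralizer_of_def centralizer_of_def conj_by_subgrp[OF N])
    qed
    ultimately show "\<exists>c\<in>centralizer_of B. \<exists>j\<in>normalizer_of (S \<inter> normalizer_of B). h = c \<otimes>\<^bsub>G\<^esub> j"
      using cj(3) unfolding T_def by blast
  qed
  define N where "N = normalizer_of S"
  have N: "subgroup N G" unfolding N_def by (rule subgroup_normalizer_of[OF subgroup.subset[OF sS]])
  interpret N: finite_group "subgrp G N" using N by (rule finite_group_subgrp)
  have SN: "S \<subseteq> N" unfolding N_def by (rule subgroup_subset_normalizer_of[OF sS])
  have core: "S \<subseteq> p_core p (subgrp G N)"
    unfolding N_def by (rule p_subgroup_le_normalizer_core[OF p pS])
  have "S \<lhd> subgrp G N"
    unfolding N.normal_iff_conj_by
  proof (intro conjI ballI)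
    show "subgroup S (subgrp G N)" using subgroup_incl[OF sS N SN] .
    show "N.conj_by g ` S = S" if "g \<in> carrier (subgrp G N)" for g
      using that conj_by_subgrp[OF N, of g] by (simp add: N_def normalizer_of_def)
  qed
  \<comment> \<open>The series consists of normal subgroups of N(S), which suffices for strong
    closure: a morphism of the fusion system agrees on its domain with conjugation by an element of
    N(S).\<close>
  then obtain n T where T: "T 0 = {\<one>\<^bsub>G\<^esub>}" "T (n::nat) = S"
      "\<And>i. i \<le> n \<Longrightarrow> T i \<lhd> subgrp G N \<and> T i \<subseteq> S"
      "\<And>i. i < n \<Longrightarrow> chief_factor (subgrp G N) (T (Suc i)) (T i)"
    using N.chief_series_exists[of S] by auto
  have sT: "subgroup (T i) G" if "i \<le> n" for i
    using T(3)[OF that] incl_subgroup[OF N] normal_imp_subgroup by blast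
  have closed: "strongly_closed (subgrp G S) (fusion_system G S) (T i)" if i: "i \<le> n" for i
    unfolding strongly_closed_def
  proof (intro conjI allI impI; (elim conjE)?)
    show "subgroup (T i) (subgrp G S)" using subS sT[OF i] T(3)[OF i] by blast
    fix A \<phi>
    assume "subgroup A (subgrp G S)" and AT: "A \<subseteq> T i"
      and \<phi>: "\<phi> \<in> fusion_system G S A (carrier (subgrp G S))"
    then have A: "subgroup A G" "A \<subseteq> S" using subS by auto
    obtain g where g: "g \<in> carrier G" "\<phi> = (\<lambda>x\<in>A. inv\<^bsub>G\<^esub> g \<otimes>\<^bsub>G\<^esub> x \<otimes>\<^bsub>G\<^esub> g)" "\<phi> ` A \<subseteq> S"
      using \<phi> unfolding fusion_system_def by auto
    have \<phi>_eq: "\<phi> ` A = conj_by g ` A"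
      unfolding g(2) by (auto simp: conj_by_def)
    obtain m where m: "m \<in> N" "\<And>a. a \<in> A \<Longrightarrow> conj_by g a = conj_by m a"
      using control[OF A g(1)] g(3) \<phi>_eq unfolding N_def by auto
    have "conj_by m a \<in> T i" if "a \<in> A" for a
      using N.normal_conj_by_mem[of "T i" m a] T(3)[OF i] m(1) that AT conj_by_subgrp[OF N m(1)]
      by auto
    then show "\<phi> ` A \<subseteq> T i" unfolding \<phi>_eq using m(2) by auto
  qed
  have cyclic: "T i \<subseteq> T (Suc i)" "cyclic_group (subgrp (subgrp G S) (T (Suc i)) Mod T i)"
    if i: "i < n" for i
  proof -
    have Suc: "Suc i \<le> n" using i by simp
    have c: "chief_factor (subgrp G N) (T (Suc i)) (T i)" using T(4)[OF i] .
    then have K: "T (Suc i) \<lhd> subgrp G N" "T i \<lhd> subgrp G N" "T i \<subseteq> T (Suc i)"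
      unfolding chief_factor_def by blast+
    then show "T i \<subseteq> T (Suc i)" by blast
    have "N.cyclic_over (T (Suc i)) (T i)"
      using chief[OF sS subset_refl D(4) sylow_in_normalizer[OF p S] subset_refl] c core T(3)[OF Suc]
      unfolding N_def by blast
    then have "cyclic_group (subgrp (subgrp G N) (T (Suc i)) Mod T i)"
      using N.cyclic_group_iff_cyclic_over normal_imp_subgroup K by blast
    \<comment> \<open>Replacing the carrier twice keeps only the second replacement, so the quotient
      is the same record whether formed within N(S) or within \<open>S\<close>.\<close>
    then show "cyclic_group (subgrp (subgrp G S) (T (Suc i)) Mod T i)" by simp
  qed
  show ?thesis
    unfolding supersolvable_fusion_def using T(1,2) closed cyclic
    by (intro exI[of _ n] exI[of _ T]) simp
qed

end
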